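(* Let $s\in\mathcal S$, let $\mathcal X$ be a Hilbert space, and let $T\in\mathcal L(\mathcal X)$ and $E,\mathbf x\in\mathcal L(\mathcal X,\mathbb C)$ be such that the pair $(E,T)$ is output-stable and observable. Define $N\in\mathcal L(\mathcal X,\mathbb C)$ by $N^*=s(T^* )E^*=\mathcal O_{E,T}^*s$, and let $$P=\mathcal O_{E,T}^*\mathcal O_{E,T}-\mathcal O_{N,T}^*\mathcal O_{N,T}\in\mathcal L(\mathcal X).$$ Assume that $P$ is strictly positive definite, i.e. $P\ge 0$ and $P^{-1}\in\mathcal L(\mathcal X)$. Let $J=\begin{bmatrix}1&0\\0&-1\end{bmatrix}$ and let $\Theta=\begin{bmatrix}a&b\\c&d\end{bmatrix}$ be a $2\times 2$ $J$-inner matrix function such that for all $z,\zeta\in\mathbb D$ $$\frac{J-\Theta(z)J\Theta(\zeta)^*}{1-z\overline{\zeta}}=\begin{bmatrix}E\\N\end{bmatrix}(I-zT)^{-1}P^{-1}(I-\overline{\zeta}T^* )^{-1}\begin{bmatrix}E^*&N^*\end{bmatrix}.$$ Let $\sigma\in\mathcal S$ be the function $$\sigma=\frac{ds-b}{a-cs},$$ and let $F^s(z)=(E-s(z)N)(I-zT)^{-1}\in\mathcal L(\mathcal X,\mathbb C)$ for $z\in\mathbb D$. Consider the problem of finding all $f\in\mathcal H(K_s)$ such that $f(T^* )E^*=\mathbf x^*$. Then: (1) All solutions $f$ of this problem are parametrized by the formula $$f=F^sP^{-1}\mathbf x^*+(a-sc)h,\qquad(\dagger)$$ where $h$ is a free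 parameter from the space $\mathcal H(K_\sigma)$; that is, a function $f$ belongs to $\mathcal H(K_s)$ and satisfies $f(T^* )E^*=\mathbf x^*$ if and only if $f$ has the form $(\dagger)$ for some $h\in\mathcal H(K_\sigma)$. (2) The representation $(\dagger)$ is orthogonal in the metric of $\mathcal H(K_s)$, i.e. $F^sP^{-1}\mathbf x^*$ and $(a-sc)h$ are orthogonal in $\mathcal H(K_s)$ for every $h\in\mathcal H(K_\sigma)$. (3) The multiplication operator $M_{a-sc}:\mathcal H(K_\sigma)\to\mathcal H(K_s)$, $h\mapsto(a-sc)h$, is isometric. (4) For every $f$ of the form $(\dagger)$, $\|f\|^2_{\mathcal H(K_s)}=\mathbf xP^{-1}\mathbf x^*+\|h\|^2_{\mathcal H(K_\sigma)}$.
   Context: $\mathbb D$ is the open unit disk, $\mathbb T$ the unit circle, and $H^2$ the Hardy space of power series $f(z)=\sum_{n\ge0}f_nz^n$ on $\mathbb D$ with square summable coefficients. $\mathcal L(\mathcal X,\mathcal Y)$ denotes the bounded linear operators between Hilbert spaces, and $\mathcal L(\mathcal X)=\mathcal L(\mathcal X,\mathcal X)$. For $E\in\mathcal L(\mathcal X,\mathbb C)$, the adjoint $E^*\in\mathcal L(\mathbb C,\mathcal X)$ is identified with a vector of $\mathcal X$; similarly for $\mathbf x^*$, $N^*$. The Schur class $\mathcal S$ is the set of holomorphic functions mapping $\mathbb D$ into the closed unit disk; as sets, $\mathcal S\subset H^2$. For $s\in\mathcal S$, $\mathcal H(K_s)$ (the de Branges-Rovnyak space) is the reproducing kernel Hilbert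 space of functions on $\mathbb D$ with the positive kernel $$K_s(z,\zeta)=\frac{1-s(z)\overline{s(\zeta)}}{1-z\overline{\zeta}};$$ it is contractively included in $H^2$. A pair $(E,T)$ with $T\in\mathcal L(\mathcal X)$, $E\in\mathcal L(\mathcal X,\mathbb C)$ is output-stable if the observability operator $$\mathcal O_{E,T}:x\mapsto E(I-zT)^{-1}x=\sum_{n=0}^\infty z^nET^nx$$ maps $\mathcal X$ into $H^2$ and is bounded; it is observable if $\mathcal O_{E,T}$ is injective. For an output-stable pair $(E,T)$ and $f(z)=\sum_{n\ge0}f_nz^n\in H^2$, one defines $$f(T^* )E^*=\sum_{n\ge0}f_nT^{*n}E^*\in\mathcal X,$$ the series converging weakly in $\mathcal X$; equivalently $f(T^* )E^*=\mathcal O_{E,T}^*f$, where the adjoint is that of $\mathcal O_{E,T}:\mathcal X\to H^2$. With $N$ defined by $N^*=s(T^* )E^*$, the pair $(N,T)$ is again output-stable, with $\mathcal O_{N,T}$ defined in the same way, so that $P$ is well defined; $P$ is positive semidefinite. A $2\times2$ matrix function $\Theta$ analytic on $\mathbb D$ is $J$-inner if $\Theta(z)J\Theta(z)^*\le J$ for all $z\in\mathbb D$ and the nontangential boundary values $\Theta(t)$ exist and satisfy $\Theta(t)J\Theta(t)^*=J$ for almost all $t\in\mathbb T$. Such a $\Theta$ satisfying the displayed kernel identity exists and is unique up to a constant $J$-unitary factor on the right, and for it the function $\sigma=(ds-b)/(a-cs)$ belongs to $\mathcal S$. $F^sP^{-1}\mathbf x^*$ denotes the function $z\mapsto F^s(z)P^{-1}\mathbf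 x^*$, and $\mathbf xP^{-1}\mathbf x^*$ is the scalar $\langle P^{-1}\mathbf x^*,\mathbf x^*\rangle_{\mathcal X}$. *)

theory Defs
  imports "HOL-Complex_Analysis.Complex_Analysis"
begin

section \<open>Complex Hilbert spaces and bounded operators\<close>

text \<open>
  The inner product \<open>cinner\<close> is linear in its first argument and conjugate linear in the second;
  norm and topology are those of the underlying real inner product \<open>Re (cinner x y)\<close>.
\<close>

class complex_hilbert_space = real_inner + complete_space +
  fixes scaleC :: "complex \<Rightarrow> 'a \<Rightarrow> 'a" (infixr \<open>*\<^sub>C\<close> 75)
    and cinner :: "'a \<Rightarrow> 'a \<Rightarrow> complex"
  assumes scaleC_add_right: "c *\<^sub>C (x + y) = c *\<^sub>C x + c *\<^sub>C y"
    and scaleC_add_left: "(c + d) *\<^sub>C x = c *\<^sub>C x + d *\<^sub>C x"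
    and scaleC_scaleC: "c *\<^sub>C d *\<^sub>C x = (c * d) *\<^sub>C x"
    and scaleC_of_real: "complex_of_real r *\<^sub>C x = r *\<^sub>R x"
    and cinner_add_left: "cinner (x + y) z = cinner x z + cinner y z"
    and cinner_scaleC_left: "cinner (c *\<^sub>C x) y = c * cinner x y"
    and cinner_commute: "cinner x y = cnj (cinner y x)"
    and Re_cinner: "Re (cinner x y) = inner x y"

instantiation complex :: complex_hilbert_space
begin

definition scaleC_complex :: "complex \<Rightarrow> complex \<Rightarrow> complex" where
  "scaleC_complex c x = c * x"

definition cinner_complex :: "complex \<Rightarrow> complex \<Rightarrow> complex" where
  "cinner_complex x y = x * cnj y"

instance
  by standard
    (simp_all add: scaleC_complex_def cinner_complex_def inner_complex_def scaleR_conv_of_real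
      algebra_simps)

end

definition bounded_clinear ::
    "('a::complex_hilbert_space \<Rightarrow> 'b::complex_hilbert_space) \<Rightarrow> bool" where
  "bounded_clinear A \<longleftrightarrow> bounded_linear A \<and> (\<forall>c x. A (c *\<^sub>C x) = c *\<^sub>C A x)"

definition cadjoint ::
    "('a::complex_hilbert_space \<Rightarrow> 'b::complex_hilbert_space) \<Rightarrow> 'b \<Rightarrow> 'a" where
  "cadjoint A = (THE B. \<forall>x y. cinner (A x) y = cinner x (B y))"

text \<open>
  For a functional \<open>E\<close> the adjoint maps \<open>\<complex>\<close> into the space and is identified with the
  image of \<open>1\<close>, so that \<open>E x = cinner x (adjoint_vec E)\<close>.
\<close>

definition adjoint_vec :: "('a::complex_hilbert_space \<Rightarrow> complex) \<Rightarrow> 'a" where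
  "adjoint_vec E = cadjoint E 1"

definition positive_operator :: "('a::complex_hilbert_space \<Rightarrow> 'a) \<Rightarrow> bool" where
  "positive_operator A \<longleftrightarrow> (\<forall>x. cinner (A x) x \<in> \<real> \<and> 0 \<le> Re (cinner (A x) x))"

definition strictly_positive_operator :: "('a::complex_hilbert_space \<Rightarrow> 'a) \<Rightarrow> bool" where
  "strictly_positive_operator A \<longleftrightarrow> positive_operator A \<and> bij A \<and> bounded_clinear (inv A)"

definition resolvent :: "('a::complex_hilbert_space \<Rightarrow> 'a) \<Rightarrow> complex \<Rightarrow> 'a \<Rightarrow> 'a" where
  "resolvent T z = inv (\<lambda>x. x - z *\<^sub>C T x)"


section \<open>Functions on the unit disk\<close>

text \<open>
  Scalar functions on the disk are encoded as total functions that vanish outside the disk, so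
  that equality of such functions is equality on the disk.
\<close>

abbreviation unit_disk :: "complex set" (\<open>\<bbbD>\<close>) where
  "\<bbbD> \<equiv> ball 0 1"

definition on_disk :: "(complex \<Rightarrow> complex) \<Rightarrow> complex \<Rightarrow> complex" where
  "on_disk f z = (if z \<in> \<bbbD> then f z else 0)"

definition schur_class :: "(complex \<Rightarrow> complex) set" where
  "schur_class =
     {s. s holomorphic_on \<bbbD> \<and> (\<forall>z\<in>\<bbbD>. norm (s z) \<le> 1) \<and> (\<forall>z. z \<notin> \<bbbD> \<longrightarrow> s z = 0)}"

abbreviation taylor_coeff :: "(complex \<Rightarrow> complex) \<Rightarrow> nat \<Rightarrow> complex" where
  "taylor_coeff f n \<equiv> fps_nth (fps_expansion f 0) n"

definition hardy2 :: "(complex \<Rightarrow> complex) set" where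
  "hardy2 = {f. f holomorphic_on \<bbbD> \<and> summable (\<lambda>n. (norm (taylor_coeff f n))\<^sup>2) \<and>
     (\<forall>z. z \<notin> \<bbbD> \<longrightarrow> f z = 0)}"

definition hardy2_inner :: "(complex \<Rightarrow> complex) \<Rightarrow> (complex \<Rightarrow> complex) \<Rightarrow> complex" where
  "hardy2_inner f g = (\<Sum>n. taylor_coeff f n * cnj (taylor_coeff g n))"

definition hardy2_norm :: "(complex \<Rightarrow> complex) \<Rightarrow> real" where
  "hardy2_norm f = sqrt (Re (hardy2_inner f f))"


section \<open>Reproducing kernel Hilbert spaces\<close>

text \<open>
  A Hilbert space \<open>H\<close> (inner product \<open>ip\<close>) of complex functions on a set \<open>D\<close>, with the same
  encoding by functions that vanish outside \<open>D\<close>.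
\<close>

definition ip_norm :: "('f \<Rightarrow> 'f \<Rightarrow> complex) \<Rightarrow> 'f \<Rightarrow> real" where
  "ip_norm ip f = sqrt (Re (ip f f))"

locale function_hilbert_space =
  fixes D :: "'z set"
    and H :: "('z \<Rightarrow> complex) set"
    and ip :: "('z \<Rightarrow> complex) \<Rightarrow> ('z \<Rightarrow> complex) \<Rightarrow> complex"
  assumes vanishes_outside: "f \<in> H \<Longrightarrow> z \<notin> D \<Longrightarrow> f z = 0"
    and zero_mem: "(\<lambda>z. 0) \<in> H"
    and add_mem: "f \<in> H \<Longrightarrow> g \<in> H \<Longrightarrow> (\<lambda>z. f z + g z) \<in> H"
    and scale_mem: "f \<in> H \<Longrightarrow> (\<lambda>z. c * f z) \<in> H"
    and ip_add_left: "f \<in> H \<Longrightarrow> g \<in> H \<Longrightarrow> k \<in> H \<Longrightarrow> ip (\<lambda>z. f z + g z) k = ip f k + ip g k"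
    and ip_scale_left: "f \<in> H \<Longrightarrow> g \<in> H \<Longrightarrow> ip (\<lambda>z. c * f z) g = c * ip f g"
    and ip_commute: "f \<in> H \<Longrightarrow> g \<in> H \<Longrightarrow> ip f g = cnj (ip g f)"
    and ip_nonneg: "f \<in> H \<Longrightarrow> 0 \<le> Re (ip f f)"
    and ip_definite: "f \<in> H \<Longrightarrow> ip f f = 0 \<Longrightarrow> f = (\<lambda>z. 0)"
    and complete: "(\<And>n. F n \<in> H) \<Longrightarrow>
      (\<forall>e>0. \<exists>n0. \<forall>m\<ge>n0. \<forall>n\<ge>n0. ip_norm ip (\<lambda>z. F m z - F n z) < e) \<Longrightarrow>
      \<exists>f\<in>H. (\<lambda>n. ip_norm ip (\<lambda>z. F n z - f z)) \<longlonglongrightarrow> 0"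

text \<open>
  These axioms determine \<open>H\<close>, and \<open>ip\<close> on \<open>H\<close>, uniquely from \<open>K\<close> (Moore--Aronszajn).
\<close>

locale reproducing_kernel_hilbert_space = function_hilbert_space D H ip
  for D :: "'z set"
    and K :: "'z \<Rightarrow> 'z \<Rightarrow> complex"
    and H :: "('z \<Rightarrow> complex) set"
    and ip :: "('z \<Rightarrow> complex) \<Rightarrow> ('z \<Rightarrow> complex) \<Rightarrow> complex" +
  assumes kernel_mem: "w \<in> D \<Longrightarrow> (\<lambda>z. if z \<in> D then K z w else 0) \<in> H"
    and reproducing: "w \<in> D \<Longrightarrow> f \<in> H \<Longrightarrow> ip f (\<lambda>z. if z \<in> D then K z w else 0) = f w"

definition dbr_kernel :: "(complex \<Rightarrow> complex) \<Rightarrow> complex \<Rightarrow> complex \<Rightarrow> complex" where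
  "dbr_kernel s z w = (1 - s z * cnj (s w)) / (1 - z * cnj w)"

definition de_branges_rovnyak_space ::
    "(complex \<Rightarrow> complex) \<Rightarrow> (complex \<Rightarrow> complex) set \<Rightarrow>
     ((complex \<Rightarrow> complex) \<Rightarrow> (complex \<Rightarrow> complex) \<Rightarrow> complex) \<Rightarrow> bool" where
  "de_branges_rovnyak_space s H ip \<longleftrightarrow> reproducing_kernel_hilbert_space \<bbbD> (dbr_kernel s) H ip"


section \<open>Observability operators and functional calculus\<close>

definition obs_op ::
    "('a::complex_hilbert_space \<Rightarrow> complex) \<Rightarrow> ('a \<Rightarrow> 'a) \<Rightarrow> 'a \<Rightarrow> complex \<Rightarrow> complex" where
  "obs_op E T x = on_disk (\<lambda>z. \<Sum>n. z ^ n * E ((T ^^ n) x))"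

definition output_stable ::
    "('a::complex_hilbert_space \<Rightarrow> complex) \<Rightarrow> ('a \<Rightarrow> 'a) \<Rightarrow> bool" where
  "output_stable E T \<longleftrightarrow>
     (\<forall>x. obs_op E T x \<in> hardy2) \<and> (\<exists>C. \<forall>x. hardy2_norm (obs_op E T x) \<le> C * norm x)"

definition observable :: "('a::complex_hilbert_space \<Rightarrow> complex) \<Rightarrow> ('a \<Rightarrow> 'a) \<Rightarrow> bool" where
  "observable E T \<longleftrightarrow> inj (obs_op E T)"

text \<open>The adjoint of the observability operator as an operator into the Hardy space.\<close>

definition obs_adj ::
    "('a::complex_hilbert_space \<Rightarrow> complex) \<Rightarrow> ('a \<Rightarrow> 'a) \<Rightarrow> (complex \<Rightarrow> complex) \<Rightarrow> 'a" where
  "obs_adj E T f = (THE v. \<forall>x. cinner x v = hardy2_inner (obs_op E T x) f)"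

text \<open>The vector \<open>f(T*)E*\<close>, as the weak sum of the series of \<open>f\<^sub>n T*\<^sup>n E*\<close>.\<close>

definition tangential_value ::
    "(complex \<Rightarrow> complex) \<Rightarrow> ('a::complex_hilbert_space \<Rightarrow> 'a) \<Rightarrow> ('a \<Rightarrow> complex) \<Rightarrow> 'a" where
  "tangential_value f T E =
     (THE v. \<forall>x. (\<lambda>n. cinner (taylor_coeff f n *\<^sub>C (cadjoint T ^^ n) (adjoint_vec E)) x)
        sums cinner v x)"

definition Fs_op ::
    "(complex \<Rightarrow> complex) \<Rightarrow> ('a::complex_hilbert_space \<Rightarrow> complex) \<Rightarrow> ('a \<Rightarrow> complex) \<Rightarrow>
     ('a \<Rightarrow> 'a) \<Rightarrow> complex \<Rightarrow> 'a \<Rightarrow> complex" where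
  "Fs_op s E N T z x = E (resolvent T z x) - s z * N (resolvent T z x)"


section \<open>J-inner matrix functions\<close>

definition mat2 :: "complex \<Rightarrow> complex \<Rightarrow> complex \<Rightarrow> complex \<Rightarrow> complex ^ 2 ^ 2" where
  "mat2 a b c d = vector [vector [a, b], vector [c, d]]"

definition J_mat :: "complex ^ 2 ^ 2" where
  "J_mat = mat2 1 0 0 (-1)"

definition mat_adjoint :: "complex ^ 2 ^ 2 \<Rightarrow> complex ^ 2 ^ 2" where
  "mat_adjoint A = map_matrix cnj (transpose A)"

definition psd_matrix :: "complex ^ 2 ^ 2 \<Rightarrow> bool" where
  "psd_matrix A \<longleftrightarrow>
     (\<forall>v. (\<Sum>i\<in>UNIV. (A *v v) $ i * cnj (v $ i)) \<in> \<real> \<and>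
          0 \<le> Re (\<Sum>i\<in>UNIV. (A *v v) $ i * cnj (v $ i)))"

definition loewner_le :: "complex ^ 2 ^ 2 \<Rightarrow> complex ^ 2 ^ 2 \<Rightarrow> bool" where
  "loewner_le A B \<longleftrightarrow> psd_matrix (B - A)"

definition stolz_region :: "complex \<Rightarrow> real \<Rightarrow> complex set" where
  "stolz_region t M = {z \<in> \<bbbD>. norm (z - t) < M * (1 - norm z)}"

definition nontangential_limit ::
    "(complex \<Rightarrow> complex ^ 2 ^ 2) \<Rightarrow> complex \<Rightarrow> complex ^ 2 ^ 2 \<Rightarrow> bool" where
  "nontangential_limit \<Theta> t L \<longleftrightarrow> (\<forall>M>1. (\<Theta> \<longlongrightarrow> L) (at t within stolz_region t M))"

definition J_inner :: "(complex \<Rightarrow> complex ^ 2 ^ 2) \<Rightarrow> bool" where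
  "J_inner \<Theta> \<longleftrightarrow>
     (\<forall>i j. (\<lambda>z. \<Theta> z $ i $ j) holomorphic_on \<bbbD>) \<and>
     (\<forall>z\<in>\<bbbD>. loewner_le (\<Theta> z ** J_mat ** mat_adjoint (\<Theta> z)) J_mat) \<and>
     (AE \<phi> in lebesgue_on {0..2 * pi}.
        \<exists>L. nontangential_limit \<Theta> (cis \<phi>) L \<and> L ** J_mat ** mat_adjoint L = J_mat)"

end

theory Submission
  imports Defs
begin

text \<open>
  Write \<open>O\<^sub>E\<close>, \<open>O\<^sub>N\<close> for the observability operators, \<open>F x = O\<^sub>E x - s O\<^sub>N x\<close> and \<open>m = a - s c\<close>, and let
  \<open>M\<close> be multiplication by \<open>m\<close>. The theorem rests on two identities.

  First, \<open>\<langle>f, F x\<rangle> = \<langle>f(T\<^sup>*)E\<^sup>*, x\<rangle>\<close> for \<open>f\<close> in \<open>H(K\<^sub>s)\<close>. This space is contractively included in the Hardy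
  space, and the adjoint of the inclusion is \<open>g \<mapsto> g - s S\<^sup>*g\<close>, where \<open>S\<close> is multiplication by \<open>s\<close>. Since
  \<open>T\<close> corresponds to the backward shift, the definition of \<open>N\<close> says \<open>S\<^sup>*O\<^sub>E = O\<^sub>N\<close>; so \<open>F x\<close> is the
  image of \<open>O\<^sub>E x\<close> under that adjoint (lemmas \<open>inclusion_adjoint\<close>, \<open>obs_N_adjoint\<close>, \<open>ip_Fs\<close>). Taking \<open>f = F y\<close>
  gives \<open>F\<^sup>*F = P\<close> (\<open>pick_op_eq\<close>).

  Second, compressing the kernel identity for \<open>\<Theta>\<close> by the row \<open>(1, - s)\<close> gives
  \<open>K\<^sub>s = F P\<^sup>-\<^sup>1F\<^sup>* + m K\<^sub>\<sigma> m\<^sup>*\<close> (\<open>kernel_split_from_J_form\<close>). Hence \<open>M\<close> maps \<open>H(K\<^sub>\<sigma>)\<close> contractively into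
  \<open>H(K\<^sub>s)\<close>, and the identity of kernels becomes the identity of operators \<open>I = F P\<^sup>-\<^sup>1F\<^sup>* + M M\<^sup>*\<close>
  (\<open>mult_adjoint\<close>). Applied to \<open>F x\<close> it yields \<open>M M\<^sup>*F = 0\<close>. As \<open>M\<close> is injective, \<open>M\<^sup>*F = 0\<close>, so the two
  ranges are orthogonal, and then \<open>M M\<^sup>*M = M\<close> yields \<open>M\<^sup>*M = I\<close>. A function with \<open>f(T\<^sup>*)E\<^sup>* = x\<close> is thus
  \<open>F P\<^sup>-\<^sup>1x + M h\<close> with \<open>h = M\<^sup>*f\<close>, and the norm formula is Pythagoras. This part is carried out for general
  kernels in the locale \<open>kernel_splitting\<close>.

  Two points use the hypotheses on \<open>P\<close> and \<open>\<Theta>\<close> in a less visible way. The resolvents exist on the whole disk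
  because invertibility of \<open>P\<close> bounds \<open>O\<^sub>E\<close> below, which makes \<open>T\<close> power bounded (\<open>obs_bounded_below\<close>). And \<open>M\<close> is
  injective because \<open>m\<close> is not identically zero, which is seen at a boundary point where \<open>\<Theta>\<close> is \<open>J\<close>-unitary
  (\<open>J_inner_denominator_nonzero\<close>).
\<close>

section \<open>Hilbert spaces of functions\<close>

context function_hilbert_space
begin

lemma ip_add_right:
  assumes "f \<in> H" "g \<in> H" "k \<in> H"
  shows "ip k (\<lambda>z. f z + g z) = ip k f + ip k g"
  using assms ip_commute[of k "\<lambda>z. f z + g z"] ip_commute[of k f] ip_commute[of k g]
  by (simp add: add_mem ip_add_left)

lemma ip_scale_right:
  assumes "f \<in> H" "g \<in> H"
  shows "ip g (\<lambda>z. c * f z) = cnj c * ip g f"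
  using assms ip_commute[of g "\<lambda>z. c * f z"] ip_commute[of g f]
  by (simp add: scale_mem ip_scale_left)

lemma diff_mem: "f \<in> H \<Longrightarrow> g \<in> H \<Longrightarrow> (\<lambda>z. f z - g z) \<in> H"
  using add_mem[of f "\<lambda>z. (-1) * g z"] scale_mem[of g "-1"] by simp

lemma ip_diff_left:
  assumes "f \<in> H" "g \<in> H" "k \<in> H"
  shows "ip (\<lambda>z. f z - g z) k = ip f k - ip g k"
  using assms ip_add_left[of f "\<lambda>z. (-1) * g z" k] ip_scale_left[of g k "-1"] scale_mem[of g "-1"]
  by simp

lemma ip_diff_right:
  assumes "f \<in> H" "g \<in> H" "k \<in> H"
  shows "ip k (\<lambda>z. f z - g z) = ip k f - ip k g"
  using assms ip_commute[of k "\<lambda>z. f z - g z"] ip_commute[of k f] ip_commute[of k g]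
  by (simp add: diff_mem ip_diff_left)

lemma ip_zero_left: "f \<in> H \<Longrightarrow> ip (\<lambda>z. 0) f = 0"
  using ip_scale_left[of f f 0] by simp

lemma ip_zero_right: "f \<in> H \<Longrightarrow> ip f (\<lambda>z. 0) = 0"
  using ip_scale_right[of f f 0] by simp

lemma norm_nonneg: "f \<in> H \<Longrightarrow> 0 \<le> ip_norm ip f"
  by (simp add: ip_norm_def ip_nonneg)

lemma norm_square: "f \<in> H \<Longrightarrow> (ip_norm ip f)\<^sup>2 = Re (ip f f)"
  by (simp add: ip_norm_def ip_nonneg)

lemma ip_self: "f \<in> H \<Longrightarrow> ip f f = complex_of_real ((ip_norm ip f)\<^sup>2)"
  using ip_commute[of f f] by (simp add: norm_square complex_eq_iff)

lemma norm_eq_0D: "f \<in> H \<Longrightarrow> ip_norm ip f = 0 \<Longrightarrow> f = (\<lambda>z. 0)"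
  using ip_self[of f] ip_definite[of f] by simp

lemma norm_zero: "ip_norm ip (\<lambda>z. 0) = 0"
  using ip_zero_left[OF zero_mem] by (simp add: ip_norm_def)

lemma norm_scale: "f \<in> H \<Longrightarrow> ip_norm ip (\<lambda>z. c * f z) = cmod c * ip_norm ip f"
proof -
  assume f: "f \<in> H"
  have "ip (\<lambda>z. c * f z) (\<lambda>z. c * f z) = (c * cnj c) * complex_of_real ((ip_norm ip f)\<^sup>2)"
    using f by (simp add: ip_scale_left ip_scale_right scale_mem ip_self)
  also have "\<dots> = complex_of_real ((cmod c)\<^sup>2 * (ip_norm ip f)\<^sup>2)"
    by (simp only: complex_norm_square[symmetric] of_real_mult)
  finally have "ip (\<lambda>z. c * f z) (\<lambda>z. c * f z) = complex_of_real ((cmod c)\<^sup>2 * (ip_norm ip f)\<^sup>2)" .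
  then have "(ip_norm ip (\<lambda>z. c * f z))\<^sup>2 = (cmod c * ip_norm ip f)\<^sup>2"
    using f norm_square[OF scale_mem[OF f, of c]] by (simp only: Re_complex_of_real power_mult_distrib)
  then show ?thesis
    using f by (simp add: norm_nonneg scale_mem)
qed

lemma norm_square_add_scale:
  assumes f: "f \<in> H" and g: "g \<in> H"
  shows "(ip_norm ip (\<lambda>z. f z + c * g z))\<^sup>2 =
    (ip_norm ip f)\<^sup>2 + 2 * Re (cnj c * ip f g) + (cmod c)\<^sup>2 * (ip_norm ip g)\<^sup>2"
proof -
  have cg: "(\<lambda>z. c * g z) \<in> H"
    using g by (rule scale_mem)
  have cc: "ip (\<lambda>z. c * g z) (\<lambda>z. c * g z) = complex_of_real ((cmod c)\<^sup>2 * (ip_norm ip g)\<^sup>2)"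
    using ip_self[OF cg] norm_scale[OF g, of c] by (simp add: power_mult_distrib)
  have gf: "ip g f = cnj (ip f g)"
    by (rule ip_commute[OF g f])
  show ?thesis
    using f g cg
    by (simp add: norm_square[OF add_mem[OF f cg]] ip_add_left ip_add_right add_mem cc
        ip_scale_left ip_scale_right gf norm_square[OF f])
qed

lemma cauchy_schwarz:
  assumes f: "f \<in> H" and g: "g \<in> H"
  shows "cmod (ip f g) \<le> ip_norm ip f * ip_norm ip g"
proof (cases "ip_norm ip g = 0")
  case True
  then have "g = (\<lambda>z. 0)"
    using norm_eq_0D[OF g] by blast
  then show ?thesis
    using ip_zero_right[OF f] norm_zero by simp
next
  case False
  define n where "n = ip_norm ip g"
  define c where "c = - ip f g / complex_of_real (n\<^sup>2)"
  have n: "n > 0"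
    using False norm_nonneg[OF g] by (simp add: n_def)
  have re: "Re (cnj c * ip f g) = - (cmod (ip f g))\<^sup>2 / n\<^sup>2"
  proof -
    have "cnj c * ip f g = - (ip f g * cnj (ip f g)) / complex_of_real (n\<^sup>2)"
      by (simp add: c_def mult.commute)
    also have "\<dots> = complex_of_real (- (cmod (ip f g))\<^sup>2 / n\<^sup>2)"
      by (simp flip: complex_norm_square)
    finally show ?thesis
      by (metis Re_complex_of_real)
  qed
  have mc: "(cmod c)\<^sup>2 * n\<^sup>2 = (cmod (ip f g))\<^sup>2 / n\<^sup>2"
  proof -
    have "cmod c = cmod (ip f g) / n\<^sup>2"
      by (simp add: c_def norm_divide norm_power)
    then show ?thesis
      using n by (simp add: power_divide power2_eq_square)
  qed
  have "0 \<le> (ip_norm ip f)\<^sup>2 + 2 * Re (cnj c * ip f g) + (cmod c)\<^sup>2 * n\<^sup>2"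
    using norm_square_add_scale[OF f g, of c]
    by (metis n_def zero_le_power2)
  then have "(cmod (ip f g))\<^sup>2 / n\<^sup>2 \<le> (ip_norm ip f)\<^sup>2"
    unfolding re mc by simp
  then have "(cmod (ip f g))\<^sup>2 \<le> (ip_norm ip f * n)\<^sup>2"
    using n by (simp add: field_simps)
  then have "cmod (ip f g) \<le> ip_norm ip f * n"
    by (rule power2_le_imp_le) (rule mult_nonneg_nonneg[OF norm_nonneg[OF f] less_imp_le[OF n]])
  then show ?thesis
    unfolding n_def .
qed

lemma parallelogram:
  assumes f: "f \<in> H" and g: "g \<in> H"
  shows "(ip_norm ip (\<lambda>z. f z - g z))\<^sup>2 =
    2 * (ip_norm ip f)\<^sup>2 + 2 * (ip_norm ip g)\<^sup>2 - (ip_norm ip (\<lambda>z. f z + g z))\<^sup>2"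
  using norm_square_add_scale[OF f g, of 1] norm_square_add_scale[OF f g, of "-1"]
  by simp

lemma tendsto_ip:
  assumes F: "\<And>n. F n \<in> H" and f: "f \<in> H" and g: "g \<in> H"
    and lim: "(\<lambda>n. ip_norm ip (\<lambda>z. F n z - f z)) \<longlonglongrightarrow> 0"
  shows "(\<lambda>n. ip (F n) g) \<longlonglongrightarrow> ip f g"
proof -
  have "(\<lambda>n. ip (F n) g - ip f g) \<longlonglongrightarrow> 0"
  proof (rule Lim_null_comparison)
    show "\<forall>\<^sub>F n in sequentially. norm (ip (F n) g - ip f g) \<le>
        ip_norm ip (\<lambda>z. F n z - f z) * ip_norm ip g"
      using cauchy_schwarz[OF diff_mem[OF F f] g] ip_diff_left[OF F f g] by simp
    show "(\<lambda>n. ip_norm ip (\<lambda>z. F n z - f z) * ip_norm ip g) \<longlonglongrightarrow> 0"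
      using tendsto_mult_right[OF lim, of "ip_norm ip g"] by simp
  qed
  then show ?thesis
    by (simp add: LIM_zero_iff)
qed

lemma tendsto_norm_square:
  assumes F: "\<And>n. F n \<in> H" and f: "f \<in> H"
    and lim: "(\<lambda>n. ip_norm ip (\<lambda>z. F n z - f z)) \<longlonglongrightarrow> 0"
  shows "(\<lambda>n. (ip_norm ip (F n))\<^sup>2) \<longlonglongrightarrow> (ip_norm ip f)\<^sup>2"
proof -
  have eq: "(ip_norm ip (F n))\<^sup>2 =
      (ip_norm ip (\<lambda>z. F n z - f z))\<^sup>2 + 2 * Re (ip (F n) f) - (ip_norm ip f)\<^sup>2" for n
    using norm_square_add_scale[OF F[of n] f, of "-1"] by simp
  have "(\<lambda>n. (ip_norm ip (\<lambda>z. F n z - f z))\<^sup>2 + 2 * Re (ip (F n) f) - (ip_norm ip f)\<^sup>2)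
      \<longlonglongrightarrow> 0\<^sup>2 + 2 * Re (ip f f) - (ip_norm ip f)\<^sup>2"
    by (intro tendsto_intros lim tendsto_ip F f)
  then show ?thesis
    unfolding eq using norm_square[OF f] by simp
qed

text \<open>
  The relation \<open>G\<close> plays the role of a bounded functional on a subspace; a relation needs no proof
  that its second component is determined by the first, and no extension to the closure. The
  representing vector is the limit of a sequence minimising \<open>\<parallel>u\<parallel>\<^sup>2 - 2 Re \<alpha>\<close> over \<open>G\<close>: the
  parallelogram law makes the sequence Cauchy, and at the minimum the first variation vanishes.
\<close>

lemma riesz_relation:
  fixes G :: "(('z \<Rightarrow> complex) \<times> complex) set"
  assumes mem: "\<And>u \<alpha>. (u, \<alpha>) \<in> G \<Longrightarrow> u \<in> H"
    and zero: "((\<lambda>z. 0), 0) \<in> G"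
    and add: "\<And>u \<alpha> v \<beta>. (u, \<alpha>) \<in> G \<Longrightarrow> (v, \<beta>) \<in> G \<Longrightarrow> ((\<lambda>z. u z + v z), \<alpha> + \<beta>) \<in> G"
    and scale: "\<And>u \<alpha> c. (u, \<alpha>) \<in> G \<Longrightarrow> ((\<lambda>z. c * u z), c * \<alpha>) \<in> G"
    and bound: "\<And>u \<alpha>. (u, \<alpha>) \<in> G \<Longrightarrow> cmod \<alpha> \<le> C * ip_norm ip u"
  obtains g where "g \<in> H" "\<And>u \<alpha>. (u, \<alpha>) \<in> G \<Longrightarrow> ip u g = \<alpha>" "ip_norm ip g \<le> \<bar>C\<bar>"
proof -
  define q where "q = (\<lambda>(u, \<alpha>). (ip_norm ip u)\<^sup>2 - 2 * Re \<alpha>)"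
  define m where "m = Inf (q ` G)"
  have qb: "- C\<^sup>2 \<le> q x" if "x \<in> G" for x
  proof -
    obtain u \<alpha> where x: "x = (u, \<alpha>)"
      by fastforce
    have "Re \<alpha> \<le> C * ip_norm ip u"
      using bound[of u \<alpha>] complex_Re_le_cmod[of \<alpha>] that x by simp
    moreover have "0 \<le> (ip_norm ip u - C)\<^sup>2"
      by simp
    ultimately show ?thesis
      by (simp add: x q_def power2_eq_square algebra_simps)
  qed
  have bdd: "bdd_below (q ` G)"
    using qb by (meson bdd_below.I2)
  have m_le: "m \<le> q x" if "x \<in> G" for x
    unfolding m_def using bdd that by (simp add: cINF_lower)
  have "\<exists>x\<in>G. q x < m + 1 / real (Suc n)" for n
  proof -
    have "m < m + 1 / real (Suc n)"
      by simp
    then have "\<exists>y\<in>q ` G. y < m + 1 / real (Suc n)"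
      unfolding m_def using zero bdd by (subst (asm) cInf_less_iff) auto
    then show ?thesis
      by blast
  qed
  then obtain X where X: "\<And>n. X n \<in> G" "\<And>n. q (X n) < m + 1 / real (Suc n)"
    by metis
  define u where "u n = fst (X n)" for n
  define \<alpha> where "\<alpha> n = snd (X n)" for n
  have uG: "(u n, \<alpha> n) \<in> G" for n
    using X(1)[of n] by (simp add: u_def \<alpha>_def)
  have uH: "u n \<in> H" for n
    using mem[OF uG] .
  have qu: "(ip_norm ip (u n))\<^sup>2 - 2 * Re (\<alpha> n) < m + 1 / real (Suc n)" for n
    using X(2)[of n] by (simp add: q_def u_def \<alpha>_def case_prod_beta)
  \<comment> \<open>The midpoint of two almost minimal pairs lies in the relation and cannot go below the infimum.\<close>
  have gap: "(ip_norm ip (\<lambda>z. u i z - u j z))\<^sup>2 \<le> 2 / real (Suc i) + 2 / real (Suc j)" for i j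
  proof -
    let ?h = "\<lambda>z. u i z + u j z"
    have hH: "?h \<in> H"
      by (rule add_mem[OF uH uH])
    have "((\<lambda>z. (1/2) * ?h z), (1/2) * (\<alpha> i + \<alpha> j)) \<in> G"
      by (rule scale[OF add[OF uG uG]])
    from m_le[OF this]
    have "m \<le> (ip_norm ip (\<lambda>z. (1/2) * ?h z))\<^sup>2 - 2 * Re ((1/2) * (\<alpha> i + \<alpha> j))"
      by (simp only: q_def prod.case)
    also have "2 * Re ((1/2) * (\<alpha> i + \<alpha> j)) = Re (\<alpha> i) + Re (\<alpha> j)"
      by simp
    also have "ip_norm ip (\<lambda>z. (1/2) * ?h z) = ip_norm ip ?h / 2"
      using norm_scale[OF hH, of "1/2"] by simp
    finally have "4 * m \<le> (ip_norm ip ?h)\<^sup>2 - 4 * (Re (\<alpha> i) + Re (\<alpha> j))"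
      by (simp add: power_divide)
    then show ?thesis
      using parallelogram[OF uH uH, of i j] qu[of i] qu[of j] by simp
  qed
  have "\<forall>e>0. \<exists>n0. \<forall>i\<ge>n0. \<forall>j\<ge>n0. ip_norm ip (\<lambda>z. u i z - u j z) < e"
  proof (intro allI impI)
    fix e :: real
    assume e: "e > 0"
    obtain n0 where n0: "1 / real (Suc n0) < e\<^sup>2 / 4"
      using nat_approx_posE[of "e\<^sup>2 / 4"] e by auto
    show "\<exists>n0. \<forall>i\<ge>n0. \<forall>j\<ge>n0. ip_norm ip (\<lambda>z. u i z - u j z) < e"
    proof (intro exI allI impI)
      fix i j
      assume "i \<ge> n0" "j \<ge> n0"
      then have "1 / real (Suc i) \<le> 1 / real (Suc n0)" "1 / real (Suc j) \<le> 1 / real (Suc n0)"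
        by (simp_all add: frac_le)
      with gap[of i j] n0 have "(ip_norm ip (\<lambda>z. u i z - u j z))\<^sup>2 < e\<^sup>2"
        by simp
      then show "ip_norm ip (\<lambda>z. u i z - u j z) < e"
        using e by (simp add: power_less_imp_less_base)
    qed
  qed
  then obtain g where g: "g \<in> H" and lim: "(\<lambda>n. ip_norm ip (\<lambda>z. u n z - g z)) \<longlonglongrightarrow> 0"
    using complete[of u] uH by blast
  have inv0: "(\<lambda>n. 1 / real (Suc n)) \<longlonglongrightarrow> 0"
    using LIMSEQ_inverse_real_of_nat by (simp add: inverse_eq_divide)
  \<comment> \<open>Perturbing along \<open>v\<close> by a real multiple gives real parts; \<open>\<i> v\<close> then gives imaginary parts.\<close>
  have re: "Re (ip g v) = Re \<beta>" if v: "(v, \<beta>) \<in> G" for v \<beta>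
  proof -
    have vH: "v \<in> H"
      using mem[OF v] .
    have pos: "0 \<le> 2 * t * (Re (ip g v) - Re \<beta>) + t\<^sup>2 * (ip_norm ip v)\<^sup>2" for t :: real
    proof -
      have "0 \<le> 2 * t * (Re (ip (u n) v) - Re \<beta>) + t\<^sup>2 * (ip_norm ip v)\<^sup>2 + 1 / real (Suc n)" for n
      proof -
        have "((\<lambda>z. u n z + complex_of_real t * v z), \<alpha> n + complex_of_real t * \<beta>) \<in> G"
          by (rule add[OF uG scale[OF v]])
        from m_le[OF this] show ?thesis
          using qu[of n] unfolding q_def
          by (simp add: norm_square_add_scale[OF uH vH] algebra_simps)
      qed
      moreover have "(\<lambda>n. 2 * t * (Re (ip (u n) v) - Re \<beta>) + t\<^sup>2 * (ip_norm ip v)\<^sup>2 + 1 / real (Suc n))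
          \<longlonglongrightarrow> 2 * t * (Re (ip g v) - Re \<beta>) + t\<^sup>2 * (ip_norm ip v)\<^sup>2 + 0"
        by (intro tendsto_intros tendsto_ip[OF uH g vH lim] inv0)
      ultimately have "0 \<le> 2 * t * (Re (ip g v) - Re \<beta>) + t\<^sup>2 * (ip_norm ip v)\<^sup>2 + 0"
        by (intro LIMSEQ_le_const) auto
      then show ?thesis
        by simp
    qed
    \<comment> \<open>A quadratic in \<open>t\<close> that is nonnegative everywhere and vanishes at 0 has no linear term;
      adding 1 to the leading coefficient avoids a case distinction on \<open>v = 0\<close>.\<close>
    define r where "r = Re (ip g v) - Re \<beta>"
    define k where "k = (ip_norm ip v)\<^sup>2 + 1"
    have k: "k > 0"
      by (simp add: k_def add_nonneg_pos)
    have "0 \<le> 2 * (- r / k) * r + (- r / k)\<^sup>2 * (ip_norm ip v)\<^sup>2"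
      using pos[of "- r / k"] by (simp add: r_def)
    also have "\<dots> \<le> 2 * (- r / k) * r + (- r / k)\<^sup>2 * k"
      by (simp add: k_def mult_left_mono)
    also have "\<dots> = - r\<^sup>2 / k"
      using k by (simp add: power2_eq_square field_simps)
    finally have "r\<^sup>2 \<le> 0"
      using k by (simp add: divide_le_0_iff)
    then show ?thesis
      by (simp add: r_def)
  qed
  have eq: "ip v g = \<beta>" if v: "(v, \<beta>) \<in> G" for v \<beta>
  proof -
    have vH: "v \<in> H"
      using mem[OF v] .
    have "Re (ip g (\<lambda>z. \<i> * v z)) = Re (\<i> * \<beta>)"
      by (rule re[OF scale[OF v]])
    then have "Im (ip g v) = - Im \<beta>"
      by (simp add: ip_scale_right[OF vH g])
    then have "ip g v = cnj \<beta>"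
      using re[OF v] by (simp add: complex_eq_iff)
    then show ?thesis
      using ip_commute[OF vH g] by simp
  qed
  have "((ip_norm ip g)\<^sup>2)\<^sup>2 \<le> C\<^sup>2 * (ip_norm ip g)\<^sup>2"
  proof (rule LIMSEQ_le)
    have "(\<lambda>n. (cmod (ip (u n) g))\<^sup>2) \<longlonglongrightarrow> (cmod (ip g g))\<^sup>2"
      by (intro tendsto_intros tendsto_ip[OF uH g g lim])
    then show "(\<lambda>n. (cmod (ip (u n) g))\<^sup>2) \<longlonglongrightarrow> ((ip_norm ip g)\<^sup>2)\<^sup>2"
      using ip_self[OF g] by (simp add: norm_power)
    show "(\<lambda>n. C\<^sup>2 * (ip_norm ip (u n))\<^sup>2) \<longlonglongrightarrow> C\<^sup>2 * (ip_norm ip g)\<^sup>2"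
      by (intro tendsto_intros tendsto_norm_square[OF uH g lim])
    have "(cmod (ip (u n) g))\<^sup>2 \<le> C\<^sup>2 * (ip_norm ip (u n))\<^sup>2" for n
      using power_mono[OF bound[OF uG[of n]], of 2] eq[OF uG[of n]] by (simp add: power_mult_distrib)
    then show "\<exists>k. \<forall>n\<ge>k. (cmod (ip (u n) g))\<^sup>2 \<le> C\<^sup>2 * (ip_norm ip (u n))\<^sup>2"
      by blast
  qed
  then have "(ip_norm ip g)\<^sup>2 * (ip_norm ip g)\<^sup>2 \<le> C\<^sup>2 * (ip_norm ip g)\<^sup>2"
    by (simp only: power2_eq_square[of "(ip_norm ip g)\<^sup>2"])
  then have "(ip_norm ip g)\<^sup>2 \<le> C\<^sup>2"
    by (cases "ip_norm ip g = 0") (simp, erule mult_right_le_imp_le, simp)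
  then have "ip_norm ip g \<le> \<bar>C\<bar>"
    using abs_le_square_iff[of "ip_norm ip g" C] norm_nonneg[OF g] by simp
  with g eq that show ?thesis
    by blast
qed

end

lemma (in function_hilbert_space) sum_mem:
  assumes "\<And>w. w \<in> W \<Longrightarrow> g w \<in> H"
  shows "(\<lambda>z. \<Sum>w\<in>W. c w * g w z) \<in> H"
  using assms by (induction W rule: infinite_finite_induct) (auto simp: zero_mem add_mem scale_mem)

lemma (in function_hilbert_space) ip_sum_left:
  assumes "\<And>w. w \<in> W \<Longrightarrow> g w \<in> H" "f \<in> H"
  shows "ip (\<lambda>z. \<Sum>w\<in>W. c w * g w z) f = (\<Sum>w\<in>W. c w * ip (g w) f)"
  using assms
  by (induction W rule: infinite_finite_induct)
    (auto simp: ip_zero_left ip_add_left ip_scale_left scale_mem sum_mem)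

lemma (in function_hilbert_space) ip_sum_right:
  assumes "\<And>w. w \<in> W \<Longrightarrow> g w \<in> H" "f \<in> H"
  shows "ip f (\<lambda>z. \<Sum>w\<in>W. c w * g w z) = (\<Sum>w\<in>W. cnj (c w) * ip f (g w))"
  using assms
  by (induction W rule: infinite_finite_induct)
    (auto simp: ip_zero_right ip_add_right ip_scale_right scale_mem sum_mem)

section \<open>Positive kernels and membership in a reproducing kernel space\<close>

definition kernel_form ::
    "('z \<Rightarrow> 'z \<Rightarrow> complex) \<Rightarrow> 'z set \<Rightarrow> ('z \<Rightarrow> complex) \<Rightarrow> complex" where
  "kernel_form K W c = (\<Sum>z\<in>W. \<Sum>w\<in>W. cnj (c z) * c w * K z w)"

definition positive_kernel :: "'z set \<Rightarrow> ('z \<Rightarrow> 'z \<Rightarrow> complex) \<Rightarrow> bool" where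
  "positive_kernel D K \<longleftrightarrow> (\<forall>W c. finite W \<longrightarrow> W \<subseteq> D \<longrightarrow> 0 \<le> Re (kernel_form K W c))"

lemma kernel_form_multiplier:
  "kernel_form (\<lambda>z w. g z * K z w * cnj (g w)) W c = kernel_form K W (\<lambda>w. c w * cnj (g w))"
  by (simp add: kernel_form_def mult_ac)

lemma kernel_form_diff:
  "kernel_form (\<lambda>z w. K z w - L z w) W c = kernel_form K W c - kernel_form L W c"
  by (simp add: kernel_form_def right_diff_distrib sum_subtractf)

context reproducing_kernel_hilbert_space
begin

abbreviation kernel_fun :: "'z \<Rightarrow> 'z \<Rightarrow> complex" where
  "kernel_fun w \<equiv> (\<lambda>z. if z \<in> D then K z w else 0)"

lemma ip_kernel_left: "w \<in> D \<Longrightarrow> f \<in> H \<Longrightarrow> ip (kernel_fun w) f = cnj (f w)"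
  using ip_commute[OF kernel_mem, of w f] reproducing[of w f] by simp

lemma norm_square_kernel_sum:
  assumes "W \<subseteq> D"
  shows "ip (\<lambda>z. \<Sum>w\<in>W. c w * kernel_fun w z) (\<lambda>z. \<Sum>w\<in>W. c w * kernel_fun w z) =
    kernel_form K W c"
proof -
  have mem: "kernel_fun w \<in> H" if "w \<in> W" for w
    using kernel_mem assms that by blast
  let ?k = "\<lambda>z. \<Sum>w\<in>W. c w * kernel_fun w z"
  have kH: "?k \<in> H"
    by (rule sum_mem) (rule mem)
  have "ip ?k ?k = (\<Sum>z\<in>W. cnj (c z) * ip ?k (kernel_fun z))"
    by (rule ip_sum_right[OF mem kH])
  also have "\<dots> = (\<Sum>z\<in>W. cnj (c z) * (\<Sum>w\<in>W. c w * K z w))"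
    using assms by (intro sum.cong refl) (simp add: reproducing[OF _ kH] subset_iff)
  finally show ?thesis
    by (simp add: kernel_form_def sum_distrib_left mult_ac)
qed

lemma positive_kernel: "positive_kernel D K"
  unfolding positive_kernel_def
proof (intro allI impI)
  fix W c
  assume W: "finite W" "W \<subseteq> D"
  have "(\<lambda>z. \<Sum>w\<in>W. c w * kernel_fun w z) \<in> H"
    using W kernel_mem by (intro sum_mem) blast
  from ip_nonneg[OF this] show "0 \<le> Re (kernel_form K W c)"
    unfolding norm_square_kernel_sum[OF W(2)] .
qed

lemma kernel_bound:
  assumes f: "f \<in> H" and W: "W \<subseteq> D"
  shows "(cmod (\<Sum>w\<in>W. c w * cnj (f w)))\<^sup>2 \<le> (ip_norm ip f)\<^sup>2 * Re (kernel_form K W c)"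
proof -
  have mem: "kernel_fun w \<in> H" if "w \<in> W" for w
    using kernel_mem W that by blast
  let ?k = "\<lambda>z. \<Sum>w\<in>W. c w * kernel_fun w z"
  have kH: "?k \<in> H"
    by (rule sum_mem) (rule mem)
  have "ip ?k f = (\<Sum>w\<in>W. c w * ip (kernel_fun w) f)"
    by (rule ip_sum_left[OF mem f])
  also have "\<dots> = (\<Sum>w\<in>W. c w * cnj (f w))"
    using W f by (intro sum.cong refl) (simp add: ip_kernel_left subset_iff)
  finally have "cmod (\<Sum>w\<in>W. c w * cnj (f w)) \<le> ip_norm ip ?k * ip_norm ip f"
    using cauchy_schwarz[OF kH f] by simp
  then have "(cmod (\<Sum>w\<in>W. c w * cnj (f w)))\<^sup>2 \<le> (ip_norm ip ?k * ip_norm ip f)\<^sup>2"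
    by (rule power_mono) simp
  also have "\<dots> = (ip_norm ip f)\<^sup>2 * Re (kernel_form K W c)"
    unfolding power_mult_distrib norm_square[OF kH] norm_square_kernel_sum[OF W] by simp
  finally show ?thesis .
qed

text \<open>
  Aronszajn's membership criterion. The bound says that pairing kernel combinations with the values
  of \<open>f\<close> is a bounded relation; its Riesz vector has the values of \<open>f\<close>. Together with
  \<open>kernel_bound\<close> this turns every inequality between kernels into a contractive inclusion or a
  contractive multiplier.
\<close>

lemma mem_if_kernel_bound:
  assumes out: "\<And>z. z \<notin> D \<Longrightarrow> f z = 0"
    and bound: "\<And>W c. finite W \<Longrightarrow> W \<subseteq> D \<Longrightarrow>
      (cmod (\<Sum>w\<in>W. c w * cnj (f w)))\<^sup>2 \<le> C\<^sup>2 * Re (kernel_form K W c)"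
  shows "f \<in> H \<and> ip_norm ip f \<le> \<bar>C\<bar>"
proof -
  define u where "u = (\<lambda>W c z. \<Sum>w\<in>W. c w * kernel_fun w z)"
  define \<alpha> where "\<alpha> = (\<lambda>W c. \<Sum>w\<in>W. c w * cnj (f w))"
  define G where "G = {(u W c, \<alpha> W c) | W c. finite W \<and> W \<subseteq> D}"
  have mem: "u W c \<in> H" if "W \<subseteq> D" for W c
    unfolding u_def using that kernel_mem by (intro sum_mem) blast
  \<comment> \<open>Two combinations are added after extending their coefficients by zero to the union.\<close>
  have extend: "u V c = u W (\<lambda>w. if w \<in> V then c w else 0)"
      "\<alpha> V c = \<alpha> W (\<lambda>w. if w \<in> V then c w else 0)" if "finite W" "V \<subseteq> W" for V W c
    unfolding u_def \<alpha>_def fun_eq_iff using that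
    by (auto intro!: sum.mono_neutral_cong_left)
  have "\<exists>g. g \<in> H \<and> (\<forall>v \<beta>. (v, \<beta>) \<in> G \<longrightarrow> ip v g = \<beta>) \<and> ip_norm ip g \<le> \<bar>\<bar>C\<bar>\<bar>"
  proof (rule riesz_relation[of G "\<bar>C\<bar>"])
    show "v \<in> H" if "(v, \<beta>) \<in> G" for v \<beta>
      using that mem by (auto simp: G_def)
    have "(u {} (\<lambda>_. 0), \<alpha> {} (\<lambda>_. 0)) \<in> G"
      unfolding G_def by blast
    then show "((\<lambda>z. 0), 0) \<in> G"
      by (simp add: u_def \<alpha>_def)
    show "((\<lambda>z. v z + w z), \<beta> + \<gamma>) \<in> G" if v: "(v, \<beta>) \<in> G" and w: "(w, \<gamma>) \<in> G" for v \<beta> w \<gamma>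
    proof -
      obtain V c where V: "v = u V c" "\<beta> = \<alpha> V c" "finite V" "V \<subseteq> D"
        using v by (auto simp: G_def)
      obtain W d where W: "w = u W d" "\<gamma> = \<alpha> W d" "finite W" "W \<subseteq> D"
        using w by (auto simp: G_def)
      let ?c = "\<lambda>x. (if x \<in> V then c x else 0) + (if x \<in> W then d x else 0)"
      have fin: "finite (V \<union> W)" "V \<union> W \<subseteq> D"
        using V W by auto
      have "(\<lambda>z. v z + w z) = u (V \<union> W) ?c"
        unfolding V(1) W(1) extend(1)[OF fin(1), of V c, simplified]
          extend(1)[OF fin(1), of W d, simplified]
        by (simp add: u_def sum.distrib[symmetric] distrib_right)
      moreover have "\<beta> + \<gamma> = \<alpha> (V \<union> W) ?c"
        unfolding V(2) W(2) extend(2)[OF fin(1), of V c, simplified]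
          extend(2)[OF fin(1), of W d, simplified]
        by (simp add: \<alpha>_def sum.distrib[symmetric] distrib_right)
      ultimately show ?thesis
        unfolding G_def using fin by blast
    qed
    show "((\<lambda>z. a * v z), a * \<beta>) \<in> G" if v: "(v, \<beta>) \<in> G" for v \<beta> a
    proof -
      obtain V c where V: "v = u V c" "\<beta> = \<alpha> V c" "finite V" "V \<subseteq> D"
        using v by (auto simp: G_def)
      have "(\<lambda>z. a * v z) = u V (\<lambda>w. a * c w)" "a * \<beta> = \<alpha> V (\<lambda>w. a * c w)"
        by (simp_all add: V u_def \<alpha>_def sum_distrib_left mult.assoc)
      then show ?thesis
        unfolding G_def using V by blast
    qed
    show "cmod \<beta> \<le> \<bar>C\<bar> * ip_norm ip v" if v: "(v, \<beta>) \<in> G" for v \<beta>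
    proof -
      obtain V c where V: "v = u V c" "\<beta> = \<alpha> V c" "finite V" "V \<subseteq> D"
        using v by (auto simp: G_def)
      have vH: "v \<in> H"
        using mem[OF V(4)] V(1) by simp
      have "(cmod \<beta>)\<^sup>2 \<le> C\<^sup>2 * Re (kernel_form K V c)"
        unfolding V(2) \<alpha>_def by (rule bound[OF V(3,4)])
      also have "\<dots> = (\<bar>C\<bar> * ip_norm ip v)\<^sup>2"
        unfolding power_mult_distrib norm_square[OF vH]
        unfolding V(1) u_def norm_square_kernel_sum[OF V(4)] by simp
      finally show ?thesis
        by (rule power2_le_imp_le)
          (rule mult_nonneg_nonneg[OF abs_ge_zero norm_nonneg[OF vH]])
    qed
  qed blast
  then obtain g where g: "g \<in> H" "\<And>v \<beta>. (v, \<beta>) \<in> G \<Longrightarrow> ip v g = \<beta>" "ip_norm ip g \<le> \<bar>\<bar>C\<bar>\<bar>"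
    by blast
  have "g w = f w" for w
  proof (cases "w \<in> D")
    case True
    have "(u {w} (\<lambda>_. 1), \<alpha> {w} (\<lambda>_. 1)) \<in> G"
      unfolding G_def using True by blast
    from g(2)[OF this] have "ip (kernel_fun w) g = cnj (f w)"
      by (simp add: u_def \<alpha>_def)
    then show ?thesis
      using ip_kernel_left[OF True g(1)] by simp
  qed (use out vanishes_outside[OF g(1)] in simp)
  then have "g = f"
    by blast
  with g show ?thesis
    by simp
qed

end

lemma bounded_adjoint:
  assumes 1: "function_hilbert_space D1 H1 ip1" and 2: "function_hilbert_space D2 H2 ip2"
    and mem: "\<And>f. f \<in> H1 \<Longrightarrow> A f \<in> H2"
    and add: "\<And>f g. f \<in> H1 \<Longrightarrow> g \<in> H1 \<Longrightarrow> A (\<lambda>z. f z + g z) = (\<lambda>z. A f z + A g z)"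
    and scale: "\<And>f c. f \<in> H1 \<Longrightarrow> A (\<lambda>z. c * f z) = (\<lambda>z. c * A f z)"
    and bound: "\<And>f. f \<in> H1 \<Longrightarrow> ip_norm ip2 (A f) \<le> C * ip_norm ip1 f"
  obtains B where "\<And>g. g \<in> H2 \<Longrightarrow> B g \<in> H1"
    "\<And>f g. f \<in> H1 \<Longrightarrow> g \<in> H2 \<Longrightarrow> ip1 f (B g) = ip2 (A f) g"
proof -
  interpret h1: function_hilbert_space D1 H1 ip1 by fact
  interpret h2: function_hilbert_space D2 H2 ip2 by fact
  have "\<exists>k. k \<in> H1 \<and> (\<forall>f\<in>H1. ip1 f k = ip2 (A f) g)" if g: "g \<in> H2" for g
  proof (rule h1.riesz_relation[of "{(f, ip2 (A f) g) | f. f \<in> H1}" "C * ip_norm ip2 g"])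
    show "((\<lambda>z. 0), 0) \<in> {(f, ip2 (A f) g) | f. f \<in> H1}"
      using scale[OF h1.zero_mem, of 0] g h1.zero_mem by (auto simp: h2.ip_zero_left)
    show "cmod \<alpha> \<le> C * ip_norm ip2 g * ip_norm ip1 u" if "(u, \<alpha>) \<in> {(f, ip2 (A f) g) | f. f \<in> H1}" for u \<alpha>
    proof -
      have u: "u \<in> H1" "\<alpha> = ip2 (A u) g"
        using that by auto
      have "cmod \<alpha> \<le> ip_norm ip2 (A u) * ip_norm ip2 g"
        unfolding u(2) by (rule h2.cauchy_schwarz[OF mem[OF u(1)] g])
      also have "\<dots> \<le> C * ip_norm ip1 u * ip_norm ip2 g"
        by (rule mult_right_mono[OF bound[OF u(1)] h2.norm_nonneg[OF g]])
      finally show ?thesis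
        by (simp add: mult_ac)
    qed
  qed (use g mem in \<open>auto simp: h1.add_mem h1.scale_mem add scale h2.ip_add_left h2.ip_scale_left\<close>)
  then obtain B where "\<And>g. g \<in> H2 \<Longrightarrow> B g \<in> H1 \<and> (\<forall>f\<in>H1. ip1 f (B g) = ip2 (A f) g)"
    by metis
  with that show ?thesis
    by blast
qed

section \<open>Taylor coefficients and the Hardy space\<close>

lemma taylor_expansion:
  assumes "f holomorphic_on \<bbbD>"
  shows "f has_fps_expansion fps_expansion f 0"
  using has_fps_expansion_fps_expansion[of "\<bbbD>" f] assms by simp

lemma taylor_sums:
  assumes "f holomorphic_on \<bbbD>" "z \<in> \<bbbD>"
  shows "(\<lambda>n. taylor_coeff f n * z ^ n) sums f z"
  by (rule has_fps_expansion_imp_sums_complex[OF taylor_expansion[OF assms(1)], of 1])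
    (use assms in \<open>auto simp: eball_def ball_def\<close>)

lemma taylor_coeff_add:
  assumes "f holomorphic_on \<bbbD>" "g holomorphic_on \<bbbD>"
  shows "taylor_coeff (\<lambda>z. f z + g z) n = taylor_coeff f n + taylor_coeff g n"
  using fps_expansion_eqI[OF has_fps_expansion_add[OF assms[THEN taylor_expansion]]] by simp

lemma taylor_coeff_diff:
  assumes "f holomorphic_on \<bbbD>" "g holomorphic_on \<bbbD>"
  shows "taylor_coeff (\<lambda>z. f z - g z) n = taylor_coeff f n - taylor_coeff g n"
  using fps_expansion_eqI[OF has_fps_expansion_diff[OF assms[THEN taylor_expansion]]] by simp

lemma taylor_coeff_cmult:
  assumes "f holomorphic_on \<bbbD>"
  shows "taylor_coeff (\<lambda>z. c * f z) n = c * taylor_coeff f n"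
  using fps_expansion_eqI[OF has_fps_expansion_cmult_left[OF taylor_expansion[OF assms]]] by simp

lemma taylor_coeff_mult_power:
  assumes "f holomorphic_on \<bbbD>"
  shows "taylor_coeff (\<lambda>z. f z * z ^ k) n = (if n < k then 0 else taylor_coeff f (n - k))"
  using fps_expansion_eqI[OF has_fps_expansion_mult[OF taylor_expansion[OF assms]
      has_fps_expansion_fps_X_power[of k]]]
  by (simp add: fps_mult_fps_X_power_commute[symmetric] fps_X_power_mult_nth)

lemma taylor_coeff_zero: "taylor_coeff (\<lambda>z. 0) n = 0"
  using taylor_coeff_cmult[of "\<lambda>z. 0" 0 n] by simp

text \<open>
  Convergence near the origin is enough. This matters for the observability operator of a pair with
  \<open>\<parallel>T\<parallel> > 1\<close>, whose series is at first known to converge on a small disk only.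
\<close>

lemma taylor_coeff_power_series:
  assumes r: "r > 0" and sums: "\<And>z. cmod z < r \<Longrightarrow> (\<lambda>n. a n * z ^ n) sums f z"
  shows "taylor_coeff f n = a n"
proof -
  have "conv_radius a \<ge> ereal r"
  proof (rule conv_radius_geI_ex')
    fix t assume "0 < t" "ereal t < ereal r"
    then show "summable (\<lambda>n. a n * of_real t ^ n)"
      using sums[of "of_real t"] by (auto simp: sums_iff)
  qed
  then have cr: "fps_conv_radius (Abs_fps a) > 0"
    using r by (simp add: fps_conv_radius_def) (meson ereal_less(2) less_le_trans)
  have "eventually (\<lambda>z. z \<in> ball 0 r) (nhds (0::complex))"
    using r by (intro eventually_nhds_in_open) auto
  then have "eventually (\<lambda>z. eval_fps (Abs_fps a) z = f z) (nhds 0)"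
  proof eventually_elim
    case (elim z)
    then show ?case
      using sums[of z] by (simp add: eval_fps_def sums_iff)
  qed
  with cr have "f has_fps_expansion Abs_fps a"
    by (simp add: has_fps_expansion_def)
  from fps_expansion_eqI[OF this] show ?thesis
    by simp
qed

lemma holomorphic_power_series:
  assumes sums: "\<And>z. z \<in> \<bbbD> \<Longrightarrow> (\<lambda>n. a n * z ^ n) sums f z"
  shows "f holomorphic_on \<bbbD>"
proof -
  have "conv_radius a \<ge> ereal 1"
  proof (rule conv_radius_geI_ex')
    fix t assume "0 < t" "ereal t < ereal 1"
    then show "summable (\<lambda>n. a n * of_real t ^ n)"
      using sums[of "of_real t"] by (auto simp: sums_iff)
  qed
  then have cr: "fps_conv_radius (Abs_fps a) \<ge> 1"
    by (simp add: fps_conv_radius_def one_ereal_def)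
  have "eval_fps (Abs_fps a) holomorphic_on \<bbbD>"
  proof (rule holomorphic_on_eval_fps)
    show "\<bbbD> \<subseteq> eball 0 (fps_conv_radius (Abs_fps a))"
      using cr by (auto simp: eball_def one_ereal_def intro!: less_le_trans[OF _ cr])
  qed
  then show ?thesis
    by (rule holomorphic_transform) (use sums in \<open>auto simp: eval_fps_def sums_iff\<close>)
qed

lemma abs_summable_mult_if_square_summable:
  fixes a b :: "nat \<Rightarrow> complex"
  assumes "summable (\<lambda>n. (cmod (a n))\<^sup>2)" "summable (\<lambda>n. (cmod (b n))\<^sup>2)"
  shows "summable (\<lambda>n. cmod (a n * b n))"
proof (rule summable_comparison_test')
  show "summable (\<lambda>n. (cmod (a n))\<^sup>2 + (cmod (b n))\<^sup>2)"
    by (rule summable_add[OF assms])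
  show "norm (cmod (a n * b n)) \<le> (cmod (a n))\<^sup>2 + (cmod (b n))\<^sup>2" for n
  proof -
    have "0 \<le> (cmod (a n) - cmod (b n))\<^sup>2" "0 \<le> cmod (a n) * cmod (b n)"
      by simp_all
    then have "cmod (a n) * cmod (b n) \<le> (cmod (a n))\<^sup>2 + (cmod (b n))\<^sup>2"
      unfolding power2_diff by linarith
    then show ?thesis
      by (simp add: norm_mult)
  qed
qed

lemma square_summable_add:
  fixes a b :: "nat \<Rightarrow> complex"
  assumes "summable (\<lambda>n. (cmod (a n))\<^sup>2)" "summable (\<lambda>n. (cmod (b n))\<^sup>2)"
  shows "summable (\<lambda>n. (cmod (a n + b n))\<^sup>2)"
proof (rule summable_comparison_test')
  show "summable (\<lambda>n. 2 * (cmod (a n))\<^sup>2 + 2 * (cmod (b n))\<^sup>2)"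
    by (intro summable_add summable_mult assms)
  show "norm ((cmod (a n + b n))\<^sup>2) \<le> 2 * (cmod (a n))\<^sup>2 + 2 * (cmod (b n))\<^sup>2" for n
  proof -
    have "(cmod (a n + b n))\<^sup>2 \<le> (cmod (a n) + cmod (b n))\<^sup>2"
      by (rule power_mono[OF norm_triangle_ineq]) simp
    moreover have "0 \<le> (cmod (a n) - cmod (b n))\<^sup>2"
      by simp
    ultimately show ?thesis
      by (simp add: power2_diff power2_sum)
  qed
qed

lemma square_summable_cmult:
  fixes a :: "nat \<Rightarrow> complex"
  assumes "summable (\<lambda>n. (cmod (a n))\<^sup>2)"
  shows "summable (\<lambda>n. (cmod (c * a n))\<^sup>2)"
  using summable_mult[OF assms, of "(cmod c)\<^sup>2"] by (simp add: norm_mult power_mult_distrib)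

lemma square_summable_power:
  assumes "cmod z < 1"
  shows "summable (\<lambda>n. (cmod (z ^ n))\<^sup>2)"
proof -
  have "summable (\<lambda>n. ((cmod z)\<^sup>2) ^ n)"
    using assms by (intro summable_geometric) (simp add: power_less_one_iff abs_square_less_1)
  moreover have "(cmod (z ^ n))\<^sup>2 = ((cmod z)\<^sup>2) ^ n" for n
    by (metis norm_power power_mult mult.commute)
  ultimately show ?thesis
    by simp
qed

lemma hardy2I:
  assumes sq: "summable (\<lambda>n. (cmod (a n))\<^sup>2)"
  defines "f \<equiv> on_disk (\<lambda>z. \<Sum>n. a n * z ^ n)"
  shows "f \<in> hardy2" "taylor_coeff f n = a n"
proof -
  have sums: "(\<lambda>n. a n * z ^ n) sums f z" if "z \<in> \<bbbD>" for z
  proof -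
    have "summable (\<lambda>n. cmod (a n * z ^ n))"
      using abs_summable_mult_if_square_summable[OF sq square_summable_power[of z]] that by simp
    then have "summable (\<lambda>n. a n * z ^ n)"
      by (rule summable_norm_cancel)
    then show ?thesis
      using that by (simp add: f_def on_disk_def sums_iff)
  qed
  have coeff: "taylor_coeff f n = a n" for n
    by (rule taylor_coeff_power_series[of 1]) (simp_all add: sums)
  then show "taylor_coeff f n = a n" .
  show "f \<in> hardy2"
    using holomorphic_power_series[OF sums] sq
    by (simp add: hardy2_def coeff) (simp add: f_def on_disk_def)
qed

lemma hardy2_holomorphic: "f \<in> hardy2 \<Longrightarrow> f holomorphic_on \<bbbD>"
  by (simp add: hardy2_def)

lemma hardy2_square_summable: "f \<in> hardy2 \<Longrightarrow> summable (\<lambda>n. (cmod (taylor_coeff f n))\<^sup>2)"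
  by (simp add: hardy2_def)

lemma hardy2_vanishes: "f \<in> hardy2 \<Longrightarrow> z \<notin> \<bbbD> \<Longrightarrow> f z = 0"
  unfolding hardy2_def by blast

lemma hardy2_eqI:
  assumes "f \<in> hardy2" "g \<in> hardy2" "\<And>n. taylor_coeff f n = taylor_coeff g n"
  shows "f = g"
proof
  fix z
  show "f z = g z"
  proof (cases "z \<in> \<bbbD>")
    case True
    then show ?thesis
      using taylor_sums[OF hardy2_holomorphic[OF assms(1)] True]
        taylor_sums[OF hardy2_holomorphic[OF assms(2)] True] assms(3) sums_unique2
      by fastforce
  next
    case False
    then show ?thesis
      using hardy2_vanishes assms by metis
  qed
qed

lemma hardy2_memI:
  assumes "f holomorphic_on \<bbbD>" "summable (\<lambda>n. (cmod (taylor_coeff f n))\<^sup>2)"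
    "\<And>z. z \<notin> \<bbbD> \<Longrightarrow> f z = 0"
  shows "f \<in> hardy2"
  unfolding hardy2_def using assms by blast

lemma hardy2_add:
  assumes f: "f \<in> hardy2" and g: "g \<in> hardy2"
  shows "(\<lambda>z. f z + g z) \<in> hardy2"
proof (rule hardy2_memI)
  show "(\<lambda>z. f z + g z) holomorphic_on \<bbbD>"
    by (rule holomorphic_on_add[OF f[THEN hardy2_holomorphic] g[THEN hardy2_holomorphic]])
  show "summable (\<lambda>n. (cmod (taylor_coeff (\<lambda>z. f z + g z) n))\<^sup>2)"
    unfolding taylor_coeff_add[OF f[THEN hardy2_holomorphic] g[THEN hardy2_holomorphic]]
    by (rule square_summable_add[OF f[THEN hardy2_square_summable] g[THEN hardy2_square_summable]])
qed (metis f g hardy2_vanishes add_0_left)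

lemma hardy2_cmult:
  assumes f: "f \<in> hardy2"
  shows "(\<lambda>z. c * f z) \<in> hardy2"
proof (rule hardy2_memI)
  show "(\<lambda>z. c * f z) holomorphic_on \<bbbD>"
    by (rule holomorphic_on_mult[OF holomorphic_on_const f[THEN hardy2_holomorphic]])
  show "summable (\<lambda>n. (cmod (taylor_coeff (\<lambda>z. c * f z) n))\<^sup>2)"
    unfolding taylor_coeff_cmult[OF f[THEN hardy2_holomorphic]]
    by (rule square_summable_cmult[OF f[THEN hardy2_square_summable]])
qed (metis f hardy2_vanishes mult_zero_right)

lemma hardy2_inner_sums:
  assumes "f \<in> hardy2" "g \<in> hardy2"
  shows "(\<lambda>n. taylor_coeff f n * cnj (taylor_coeff g n)) sums hardy2_inner f g"
  unfolding hardy2_inner_def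
  by (rule summable_sums, rule summable_norm_cancel, rule abs_summable_mult_if_square_summable)
    (simp_all add: hardy2_square_summable assms)

lemma hardy2_norm_sums:
  assumes "f \<in> hardy2"
  shows "(\<lambda>n. (cmod (taylor_coeff f n))\<^sup>2) sums Re (hardy2_inner f f)"
  using sums_Re[OF hardy2_inner_sums[OF assms assms]]
  by (simp add: complex_norm_square[symmetric] del: of_real_power)

lemma hardy2_norm_eq: "hardy2_norm = ip_norm hardy2_inner"
  by (simp add: fun_eq_iff hardy2_norm_def ip_norm_def)

lemma hardy2_norm_square:
  assumes "f \<in> hardy2"
  shows "(ip_norm hardy2_inner f)\<^sup>2 = (\<Sum>n. (cmod (taylor_coeff f n))\<^sup>2)"
    "0 \<le> Re (hardy2_inner f f)"
proof -
  show "0 \<le> Re (hardy2_inner f f)"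
    using hardy2_norm_sums[OF assms] by (simp add: sums_iff) (metis suminf_nonneg zero_le_power2)
  then show "(ip_norm hardy2_inner f)\<^sup>2 = (\<Sum>n. (cmod (taylor_coeff f n))\<^sup>2)"
    using hardy2_norm_sums[OF assms] by (simp add: ip_norm_def sums_iff)
qed

text \<open>
  Coefficients converge one by one; the Cauchy bound on each finite partial sum survives the limit and
  shows that the limiting coefficients are square summable and that the convergence is in norm.
\<close>

lemma hardy2_complete:
  assumes F: "\<And>n. F n \<in> hardy2"
    and cauchy: "\<And>e. e > 0 \<Longrightarrow>
      \<exists>n0. \<forall>m\<ge>n0. \<forall>n\<ge>n0. ip_norm hardy2_inner (\<lambda>z. F m z - F n z) < e"
  shows "\<exists>f\<in>hardy2. (\<lambda>n. ip_norm hardy2_inner (\<lambda>z. F n z - f z)) \<longlonglongrightarrow> 0"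
proof -
  define a where "a m n = taylor_coeff (F m) n" for m n
  have dmem: "(\<lambda>z. f z - g z) \<in> hardy2" if "f \<in> hardy2" "g \<in> hardy2" for f g
    using hardy2_add[OF that(1) hardy2_cmult[OF that(2), of "-1"]] by simp
  have dcoeff: "taylor_coeff (\<lambda>z. F m z - F k z) n = a m n - a k n" for m k n
    unfolding a_def by (intro taylor_coeff_diff hardy2_holomorphic F)
  have partial: "(\<Sum>n<N. (cmod (a m n - a k n))\<^sup>2) \<le>
      (ip_norm hardy2_inner (\<lambda>z. F m z - F k z))\<^sup>2" for m k N
    using hardy2_square_summable[OF dmem[OF F F], of m k]
    unfolding hardy2_norm_square(1)[OF dmem[OF F F]] dcoeff
    by (intro sum_le_suminf) auto
  have single: "cmod (a m n - a k n) \<le> ip_norm hardy2_inner (\<lambda>z. F m z - F k z)" for m k n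
  proof (rule power2_le_imp_le)
    have "(cmod (a m n - a k n))\<^sup>2 \<le> (\<Sum>n<Suc n. (cmod (a m n - a k n))\<^sup>2)"
      by (simp add: sum_nonneg)
    then show "(cmod (a m n - a k n))\<^sup>2 \<le> (ip_norm hardy2_inner (\<lambda>z. F m z - F k z))\<^sup>2"
      using partial[of m k "Suc n"] by linarith
    show "0 \<le> ip_norm hardy2_inner (\<lambda>z. F m z - F k z)"
      by (simp add: ip_norm_def hardy2_norm_square(2)[OF dmem[OF F F]])
  qed
  have "Cauchy (\<lambda>m. a m n)" for n
  proof (rule metric_CauchyI)
    fix e :: real
    assume "0 < e"
    then obtain n0 where "\<And>m k. m \<ge> n0 \<Longrightarrow> k \<ge> n0 \<Longrightarrow>
        ip_norm hardy2_inner (\<lambda>z. F m z - F k z) < e"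
      using cauchy by blast
    then show "\<exists>M. \<forall>m\<ge>M. \<forall>k\<ge>M. dist (a m n) (a k n) < e"
      unfolding dist_norm using single le_less_trans by blast
  qed
  then have "\<exists>l. (\<lambda>m. a m n) \<longlonglongrightarrow> l" for n
    by (simp add: Cauchy_convergent_iff convergent_def)
  then obtain b where b: "\<And>n. (\<lambda>m. a m n) \<longlonglongrightarrow> b n"
    by metis
  have tail: "\<exists>m0. \<forall>m\<ge>m0. \<forall>N. (\<Sum>n<N. (cmod (a m n - b n))\<^sup>2) \<le> e\<^sup>2" if e: "e > 0" for e :: real
  proof -
    obtain m0 where m0: "\<And>m k. m \<ge> m0 \<Longrightarrow> k \<ge> m0 \<Longrightarrow>
        ip_norm hardy2_inner (\<lambda>z. F m z - F k z) < e"
      using cauchy[OF e] by blast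
    have "(\<Sum>n<N. (cmod (a m n - b n))\<^sup>2) \<le> e\<^sup>2" if m: "m \<ge> m0" for m N
    proof (rule LIMSEQ_le_const2)
      show "(\<lambda>k. \<Sum>n<N. (cmod (a m n - a k n))\<^sup>2) \<longlonglongrightarrow> (\<Sum>n<N. (cmod (a m n - b n))\<^sup>2)"
        by (intro tendsto_intros b)
      have "(\<Sum>n<N. (cmod (a m n - a k n))\<^sup>2) \<le> e\<^sup>2" if "k \<ge> m0" for k
      proof (rule order_trans[OF partial power_mono])
        show "ip_norm hardy2_inner (\<lambda>z. F m z - F k z) \<le> e"
          using m0[OF m that] by simp
        show "0 \<le> ip_norm hardy2_inner (\<lambda>z. F m z - F k z)"
          by (rule order_trans[OF norm_ge_zero single])
      qed
      then show "\<exists>K. \<forall>k\<ge>K. (\<Sum>n<N. (cmod (a m n - a k n))\<^sup>2) \<le> e\<^sup>2"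
        by blast
    qed
    then show ?thesis
      by blast
  qed
  obtain m1 where m1: "\<And>N. (\<Sum>n<N. (cmod (a m1 n - b n))\<^sup>2) \<le> 1"
    using tail[of 1] by auto
  have "summable (\<lambda>n. (cmod (a m1 n - b n))\<^sup>2)"
    by (rule summableI_nonneg_bounded[OF _ m1]) simp
  then have "summable (\<lambda>n. (cmod (a m1 n + (-1) * (a m1 n - b n)))\<^sup>2)"
    unfolding a_def
    by (intro square_summable_add square_summable_cmult hardy2_square_summable F)
  then have sq: "summable (\<lambda>n. (cmod (b n))\<^sup>2)"
    by simp
  define f where "f = on_disk (\<lambda>z. \<Sum>n. b n * z ^ n)"
  have f: "f \<in> hardy2" "\<And>n. taylor_coeff f n = b n"
    using hardy2I[OF sq] by (simp_all add: f_def)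
  have fcoeff: "taylor_coeff (\<lambda>z. F m z - f z) n = a m n - b n" for m n
    using taylor_coeff_diff[OF hardy2_holomorphic[OF F] hardy2_holomorphic[OF f(1)], of m n] f(2)
    by (simp add: a_def)
  have "(\<lambda>n. ip_norm hardy2_inner (\<lambda>z. F n z - f z)) \<longlonglongrightarrow> 0"
  proof (rule LIMSEQ_I)
    fix r :: real
    assume r: "0 < r"
    then obtain m0 where m0: "\<And>m N. m \<ge> m0 \<Longrightarrow> (\<Sum>n<N. (cmod (a m n - b n))\<^sup>2) \<le> (r/2)\<^sup>2"
      using tail[of "r/2"] by auto
    have "ip_norm hardy2_inner (\<lambda>z. F m z - f z) < r" if m: "m \<ge> m0" for m
    proof -
      have "(ip_norm hardy2_inner (\<lambda>z. F m z - f z))\<^sup>2 \<le> (r/2)\<^sup>2"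
        using hardy2_square_summable[OF dmem[OF F f(1)], of m]
        unfolding hardy2_norm_square(1)[OF dmem[OF F f(1)]] fcoeff
        by (intro suminf_le_const m0 m)
      then have "ip_norm hardy2_inner (\<lambda>z. F m z - f z) \<le> r/2"
        by (rule power2_le_imp_le) (use r in simp)
      then show ?thesis
        using r by simp
    qed
    then show "\<exists>no. \<forall>n\<ge>no. norm (ip_norm hardy2_inner (\<lambda>z. F n z - f z) - 0) < r"
      using hardy2_norm_square(2)[OF dmem[OF F f(1)]] by (auto simp: ip_norm_def)
  qed
  with f(1) show ?thesis
    by blast
qed

definition szego_kernel :: "complex \<Rightarrow> complex \<Rightarrow> complex" where
  "szego_kernel z w = 1 / (1 - z * cnj w)"

lemma szego_kernel_fun:
  assumes w: "w \<in> \<bbbD>"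
  shows "(\<lambda>z. if z \<in> \<bbbD> then szego_kernel z w else 0) \<in> hardy2"
    "taylor_coeff (\<lambda>z. if z \<in> \<bbbD> then szego_kernel z w else 0) n = cnj w ^ n"
proof -
  have "(\<lambda>z. if z \<in> \<bbbD> then szego_kernel z w else 0) = on_disk (\<lambda>z. \<Sum>n. cnj w ^ n * z ^ n)"
  proof
    fix z
    have "(\<Sum>n. cnj w ^ n * z ^ n) = 1 / (1 - z * cnj w)" if "z \<in> \<bbbD>"
    proof -
      have "cmod (cnj w * z) < 1"
        using mult_strict_mono'[of "cmod w" 1 "cmod z" 1] w that by (simp add: norm_mult)
      from suminf_geometric[OF this] show ?thesis
        by (simp add: power_mult_distrib mult.commute)
    qed
    then show "(if z \<in> \<bbbD> then szego_kernel z w else 0) = on_disk (\<lambda>z. \<Sum>n. cnj w ^ n * z ^ n) z"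
      by (simp add: on_disk_def szego_kernel_def)
  qed
  moreover have "summable (\<lambda>n. (cmod (cnj w ^ n))\<^sup>2)"
    using w by (intro square_summable_power) simp
  ultimately show "(\<lambda>z. if z \<in> \<bbbD> then szego_kernel z w else 0) \<in> hardy2"
    "taylor_coeff (\<lambda>z. if z \<in> \<bbbD> then szego_kernel z w else 0) n = cnj w ^ n"
    by (simp_all add: hardy2I)
qed

interpretation hardy2: reproducing_kernel_hilbert_space "\<bbbD>" szego_kernel hardy2 hardy2_inner
proof
  show "(\<lambda>z. 0) \<in> hardy2"
    by (simp add: hardy2_def taylor_coeff_zero)
  show "hardy2_inner (\<lambda>z. f z + g z) k = hardy2_inner f k + hardy2_inner g k"
    if "f \<in> hardy2" "g \<in> hardy2" "k \<in> hardy2" for f g k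
    using sums_unique2[OF hardy2_inner_sums[OF hardy2_add[OF that(1,2)] that(3)]
        sums_add[OF hardy2_inner_sums[OF that(1,3)] hardy2_inner_sums[OF that(2,3)],
          folded distrib_right, folded taylor_coeff_add[OF that(1,2)[THEN hardy2_holomorphic]]]] .
  show "hardy2_inner (\<lambda>z. c * f z) g = c * hardy2_inner f g"
    if "f \<in> hardy2" "g \<in> hardy2" for f g c
    using sums_unique2[OF hardy2_inner_sums[OF hardy2_cmult[OF that(1)] that(2)]
        sums_mult[OF hardy2_inner_sums[OF that],
          folded mult.assoc, folded taylor_coeff_cmult[OF that(1)[THEN hardy2_holomorphic]]]] .
  show "hardy2_inner f g = cnj (hardy2_inner g f)" if "f \<in> hardy2" "g \<in> hardy2" for f g
    using sums_unique2[OF hardy2_inner_sums[OF that]]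
      sums_cnj[THEN iffD2, OF hardy2_inner_sums[OF that(2,1)]]
    by (simp add: mult.commute)
  show "f = (\<lambda>z. 0)" if f: "f \<in> hardy2" and 0: "hardy2_inner f f = 0" for f
  proof -
    have "(\<Sum>n. (cmod (taylor_coeff f n))\<^sup>2) = 0"
      using hardy2_norm_sums[OF f] 0 by (simp add: sums_iff)
    then have "taylor_coeff f n = 0" for n
      using suminf_eq_zero_iff[OF hardy2_square_summable[OF f]] by simp
    then show ?thesis
      using hardy2_eqI[OF f, of "\<lambda>z. 0"] by (simp add: taylor_coeff_zero hardy2_def)
  qed
  show "(\<lambda>z. if z \<in> \<bbbD> then szego_kernel z w else 0) \<in> hardy2" if "w \<in> \<bbbD>" for w
    by (rule szego_kernel_fun(1)[OF that])
  show "hardy2_inner f (\<lambda>z. if z \<in> \<bbbD> then szego_kernel z w else 0) = f w"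
    if "w \<in> \<bbbD>" "f \<in> hardy2" for w f
    using sums_unique2[OF hardy2_inner_sums[OF that(2) szego_kernel_fun(1)[OF that(1)],
          unfolded szego_kernel_fun(2)[OF that(1)] complex_cnj_power complex_cnj_cnj]
        taylor_sums[OF hardy2_holomorphic[OF that(2)] that(1)]] .
qed (simp_all add: hardy2_vanishes hardy2_add hardy2_cmult hardy2_norm_square(2)
    hardy2_complete)

lemma hardy2_inner_power:
  shows on_disk_power_mem: "on_disk (\<lambda>z. z ^ n) \<in> hardy2"
    and "f \<in> hardy2 \<Longrightarrow> hardy2_inner f (on_disk (\<lambda>z. z ^ n)) = taylor_coeff f n"
proof -
  define \<delta> :: "nat \<Rightarrow> complex" where "\<delta> k = (if k = n then 1 else 0)" for k
  have "(\<Sum>k. \<delta> k * z ^ k) = z ^ n" for z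
  proof -
    have "(\<lambda>k. \<delta> k * z ^ k) = (\<lambda>k. if k = n then z ^ k else 0)"
      by (auto simp: \<delta>_def)
    then show ?thesis
      using sums_single[of n "\<lambda>k. z ^ k"] by (simp add: sums_iff)
  qed
  then have eq: "on_disk (\<lambda>z. \<Sum>k. \<delta> k * z ^ k) = on_disk (\<lambda>z. z ^ n)"
    by simp
  have "summable (\<lambda>k. (cmod (\<delta> k))\<^sup>2)"
    by (rule summable_finite[of "{n}"]) (simp_all add: \<delta>_def)
  note mem = hardy2I[OF this, unfolded eq]
  show "on_disk (\<lambda>z. z ^ n) \<in> hardy2"
    by (rule mem(1))
  assume f: "f \<in> hardy2"
  have "(\<lambda>k. taylor_coeff f k * cnj (\<delta> k)) sums taylor_coeff f n"
  proof -
    have "(\<lambda>k. taylor_coeff f k * cnj (\<delta> k)) = (\<lambda>k. if k = n then taylor_coeff f k else 0)"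
      by (auto simp: \<delta>_def)
    then show ?thesis
      using sums_single[of n "taylor_coeff f"] by simp
  qed
  then show "hardy2_inner f (on_disk (\<lambda>z. z ^ n)) = taylor_coeff f n"
    using sums_unique2[OF hardy2_inner_sums[OF f mem(1), unfolded mem(2)]] by blast
qed

section \<open>Adjoints and resolvents on an abstract Hilbert space\<close>

instance complex_hilbert_space \<subseteq> banach ..

lemma cinner_add_right: "cinner x (y + z) = cinner x y + cinner x z"
  by (simp only: cinner_commute[of x] cinner_add_left complex_cnj_add)

lemma cinner_scaleC_right: "cinner x (c *\<^sub>C y) = cnj c * cinner x y"
  by (simp only: cinner_commute[of x] cinner_scaleC_left complex_cnj_mult)

lemma cinner_zero_left [simp]: "cinner 0 y = 0"
  using cinner_add_left[of 0 0 y] by simp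

lemma cinner_zero_right [simp]: "cinner x 0 = 0"
  using cinner_add_right[of x 0 0] by simp

lemma cinner_diff_left: "cinner (x - y) z = cinner x z - cinner y z"
  using cinner_add_left[of "x - y" y z] by simp

lemma cinner_diff_right: "cinner x (y - z) = cinner x y - cinner x z"
  using cinner_add_right[of x "y - z" z] by simp

lemma cinner_self: "cinner x x = complex_of_real ((norm x)\<^sup>2)"
  using arg_cong[OF cinner_commute[of x x], of Im] Re_cinner[of x x]
  by (simp add: complex_eq_iff power2_norm_eq_inner)

lemma cinner_ext: "(\<And>x. cinner x v = cinner x w) \<Longrightarrow> v = w"
  using cinner_self[of "v - w"] by (simp add: cinner_diff_right)

lemma inj_cinner: "inj (cinner :: 'a::complex_hilbert_space \<Rightarrow> 'a \<Rightarrow> complex)"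
proof (rule injI)
  fix x y :: 'a
  assume "cinner x = cinner y"
  then have "cinner z x = cinner z y" for z
    by (simp only: cinner_commute[of z])
  then show "x = y"
    by (rule cinner_ext)
qed

lemma norm_scaleC: "norm (c *\<^sub>C x) = cmod c * norm x"
proof -
  have "complex_of_real ((norm (c *\<^sub>C x))\<^sup>2) = (c * cnj c) * complex_of_real ((norm x)\<^sup>2)"
    by (simp only: cinner_self[symmetric] cinner_scaleC_left cinner_scaleC_right mult_ac)
  also have "\<dots> = complex_of_real ((cmod c * norm x)\<^sup>2)"
    by (simp only: complex_norm_square[symmetric] of_real_mult[symmetric] power_mult_distrib)
  finally have "(norm (c *\<^sub>C x))\<^sup>2 = (cmod c * norm x)\<^sup>2"
    by (simp only: of_real_eq_iff)
  then show ?thesis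
    by (rule power2_eq_imp_eq) simp_all
qed

text \<open>
  The map \<open>x \<mapsto> \<langle>x, \<cdot>\<rangle>\<close> is linear and realises an abstract Hilbert space as a Hilbert space of
  functions on itself. In this way \<open>riesz_relation\<close> and the Cauchy--Schwarz inequality apply to
  vectors as well.
\<close>

definition vector_fun_ip ::
    "('a::complex_hilbert_space \<Rightarrow> complex) \<Rightarrow> ('a \<Rightarrow> complex) \<Rightarrow> complex" where
  "vector_fun_ip f g = cinner (inv cinner f) (inv cinner g)"

lemma vector_fun_ip: "vector_fun_ip (cinner x) (cinner y) = cinner x y"
  by (simp add: vector_fun_ip_def inv_f_f[OF inj_cinner])

lemma cinner_lincomb:
  "(\<lambda>z. cinner x z + cinner y z) = cinner (x + y)"
  "(\<lambda>z. c * cinner x z) = cinner (c *\<^sub>C x)"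
  "(\<lambda>z. cinner x z - cinner y z) = cinner (x - y)"
  "(\<lambda>z. 0) = cinner 0"
  by (simp_all add: fun_eq_iff cinner_add_left cinner_scaleC_left cinner_diff_left)

lemma vector_fun_norm: "ip_norm vector_fun_ip (cinner x) = norm x"
  by (simp add: ip_norm_def vector_fun_ip cinner_self del: of_real_power)

lemma function_hilbert_space_vectors:
  "function_hilbert_space UNIV (range (cinner :: 'a::complex_hilbert_space \<Rightarrow> _)) vector_fun_ip"
proof
  fix F :: "nat \<Rightarrow> 'a \<Rightarrow> complex"
  assume F: "\<And>n. F n \<in> range cinner"
    and cauchy: "\<forall>e>0. \<exists>n0. \<forall>m\<ge>n0. \<forall>n\<ge>n0. ip_norm vector_fun_ip (\<lambda>z. F m z - F n z) < e"
  have "\<forall>n. \<exists>x. F n = cinner x"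
    using F by blast
  then obtain x where x: "\<And>n. F n = cinner (x n)"
    by metis
  have "Cauchy x"
    unfolding Cauchy_def dist_norm
    using cauchy by (simp add: x cinner_lincomb vector_fun_norm)
  then obtain l where "x \<longlonglongrightarrow> l"
    by (auto simp: Cauchy_convergent_iff convergent_def)
  then have "(\<lambda>n. norm (x n - l)) \<longlonglongrightarrow> 0"
    by (simp add: LIM_zero tendsto_norm_zero)
  then have "(\<lambda>n. ip_norm vector_fun_ip (\<lambda>z. F n z - cinner l z)) \<longlonglongrightarrow> 0"
    by (simp add: x cinner_lincomb vector_fun_norm)
  then show "\<exists>f\<in>range cinner. (\<lambda>n. ip_norm vector_fun_ip (\<lambda>z. F n z - f z)) \<longlonglongrightarrow> 0"
    by blast
next
  show "0 \<le> Re (vector_fun_ip f f)" if "f \<in> range cinner" for f :: "'a \<Rightarrow> complex"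
    using that by (auto simp: vector_fun_ip cinner_self)
  show "f = (\<lambda>z. 0)" if "f \<in> range cinner" "vector_fun_ip f f = 0" for f :: "'a \<Rightarrow> complex"
    using that by (auto simp: vector_fun_ip cinner_self)
  show "vector_fun_ip f g = cnj (vector_fun_ip g f)" if "f \<in> range cinner" "g \<in> range cinner"
    for f g :: "'a \<Rightarrow> complex"
  proof -
    from that obtain x y where "f = cinner x" "g = cinner y"
      by blast
    then show ?thesis
      by (simp only: vector_fun_ip cinner_commute[of x y] complex_cnj_cnj)
  qed
  show "(\<lambda>z. 0) \<in> range (cinner :: 'a \<Rightarrow> _)"
    unfolding cinner_lincomb(4) by blast
qed (auto simp: cinner_lincomb(1-3) vector_fun_ip cinner_add_left cinner_scaleC_left)

lemma norm_cinner_le: "cmod (cinner x y) \<le> norm x * norm y"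
  using function_hilbert_space.cauchy_schwarz[OF function_hilbert_space_vectors, of "cinner x" "cinner y"]
  by (simp add: vector_fun_ip vector_fun_norm)

lemma riesz_representation:
  fixes \<phi> :: "'a::complex_hilbert_space \<Rightarrow> complex"
  assumes add: "\<And>x y. \<phi> (x + y) = \<phi> x + \<phi> y" and scale: "\<And>c x. \<phi> (c *\<^sub>C x) = c * \<phi> x"
    and bound: "\<And>x. cmod (\<phi> x) \<le> C * norm x"
  shows "\<exists>!v. \<forall>x. cinner x v = \<phi> x"
proof -
  have "\<exists>g. g \<in> range cinner \<and> (\<forall>x. vector_fun_ip (cinner x) g = \<phi> x)"
  proof (rule function_hilbert_space.riesz_relation[OF function_hilbert_space_vectors,
        of "{(cinner x, \<phi> x) | x. True}" C])
    have "\<phi> 0 = 0"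
      using add[of 0 0] by simp
    then show "((\<lambda>z. 0), 0) \<in> {(cinner x, \<phi> x) | x. True}"
      unfolding cinner_lincomb(4) by force
    show "((\<lambda>z. u z + v z), \<alpha> + \<beta>) \<in> {(cinner x, \<phi> x) | x. True}"
      if "(u, \<alpha>) \<in> {(cinner x, \<phi> x) | x. True}" "(v, \<beta>) \<in> {(cinner x, \<phi> x) | x. True}" for u v \<alpha> \<beta>
      using that by (auto simp: cinner_lincomb add[symmetric])
    show "((\<lambda>z. c * u z), c * \<alpha>) \<in> {(cinner x, \<phi> x) | x. True}"
      if "(u, \<alpha>) \<in> {(cinner x, \<phi> x) | x. True}" for u \<alpha> c
      using that by (auto simp: cinner_lincomb scale[symmetric])
    show "cmod \<alpha> \<le> C * ip_norm vector_fun_ip u" if "(u, \<alpha>) \<in> {(cinner x, \<phi> x) | x. True}" for u \<alpha>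
      using that bound by (auto simp: vector_fun_norm)
  qed auto
  then obtain v where "\<forall>x. cinner x v = \<phi> x"
    by (auto simp: vector_fun_ip)
  then show ?thesis
    by (metis cinner_ext)
qed

lemma bounded_clinearD:
  assumes "bounded_clinear A"
  shows "A (x + y) = A x + A y" "A (x - y) = A x - A y" "A (c *\<^sub>C x) = c *\<^sub>C A x"
    "\<exists>K>0. \<forall>x. norm (A x) \<le> norm x * K" "bounded_linear A" "A 0 = 0"
proof -
  show bl: "bounded_linear A"
    using assms by (simp add: bounded_clinear_def)
  interpret bounded_linear A by fact
  show "A (x + y) = A x + A y" "A (x - y) = A x - A y" "A (c *\<^sub>C x) = c *\<^sub>C A x"
    "\<exists>K>0. \<forall>x. norm (A x) \<le> norm x * K" "A 0 = 0"
    using assms by (auto simp: add diff bounded_clinear_def zero intro!: pos_bounded)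
qed

lemma cinner_cadjoint:
  assumes A: "bounded_clinear A"
  shows "cinner (A x) y = cinner x (cadjoint A y)"
proof -
  obtain K where K: "\<And>x. norm (A x) \<le> norm x * K"
    using bounded_clinearD(4)[OF A] by blast
  have "\<exists>!v. \<forall>x. cinner x v = cinner (A x) y" for y
  proof (rule riesz_representation)
    show "cmod (cinner (A x) y) \<le> (K * norm y) * norm x" for x
      using norm_cinner_le[of "A x" y] mult_right_mono[OF K[of x] norm_ge_zero[of y]]
      by (simp add: mult_ac)
  qed (simp_all add: bounded_clinearD[OF A] cinner_add_left cinner_scaleC_left)
  then obtain B where B: "\<And>x y. cinner (A x) y = cinner x (B y)"
    by metis
  have "\<forall>x y. cinner (A x) y = cinner x (cadjoint A y)"
    unfolding cadjoint_def
  proof (rule theI[of _ B])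
    show "B' = B" if "\<forall>x y. cinner (A x) y = cinner x (B' y)" for B'
      by (rule ext, rule cinner_ext) (metis that B)
  qed (use B in blast)
  then show ?thesis
    by blast
qed

lemma cinner_adjoint_vec:
  assumes "bounded_clinear E"
  shows "cinner x (adjoint_vec E) = E x"
  using cinner_cadjoint[OF assms, of x 1] by (simp add: adjoint_vec_def cinner_complex_def)

lemma cinner_cadjoint_power:
  fixes T :: "'a::complex_hilbert_space \<Rightarrow> 'a"
  assumes "bounded_clinear T"
  shows "cinner x ((cadjoint T ^^ n) y) = cinner ((T ^^ n) x) y"
proof (induction n arbitrary: x)
  case (Suc n)
  show ?case
    by (simp add: cinner_cadjoint[OF assms, symmetric] Suc funpow_swap1[of T])
qed simp

lemma scaleC_one: "1 *\<^sub>C x = x"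
  using scaleC_of_real[of 1 x] by simp

lemma scaleC_diff_right: "c *\<^sub>C (x - y) = c *\<^sub>C x - c *\<^sub>C y"
  using scaleC_add_right[of c "x - y" y] by simp

lemma scaleC_scaleR: "c *\<^sub>C (r *\<^sub>R x) = r *\<^sub>R (c *\<^sub>C x)"
  by (simp only: scaleC_of_real[symmetric] scaleC_scaleC mult.commute)

lemma bounded_linear_scaleC: "bounded_linear (\<lambda>x. c *\<^sub>C x)"
  by (rule bounded_linear_intro[where K = "cmod c"])
    (simp_all add: scaleC_add_right scaleC_scaleR norm_scaleC)

lemma bounded_clinear_funpow:
  fixes T :: "'a::complex_hilbert_space \<Rightarrow> 'a"
  assumes "bounded_clinear T"
  shows "bounded_clinear (T ^^ n)"
proof (induction n)
  case 0
  then show ?case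
    by (simp add: bounded_clinear_def bounded_linear_ident id_def)
next
  case (Suc n)
  then show ?case
    using bounded_linear_compose[of T "T ^^ n"] assms by (simp add: bounded_clinear_def o_def)
qed

text \<open>
  A power bounded operator has \<open>I - z T\<close> invertible for \<open>\<bar>z\<bar> < 1\<close>, by the Neumann series. Output
  stability gives no bound \<open>\<parallel>T\<parallel> \<le> 1\<close>, so power boundedness is the right hypothesis here.
\<close>

context
  fixes T :: "'a::complex_hilbert_space \<Rightarrow> 'a" and C :: real
  assumes T: "bounded_clinear T" and power_bounded: "\<And>n x. norm ((T ^^ n) x) \<le> C * norm x"
begin

lemma neumann_summable:
  assumes "cmod z < 1"
  shows "summable (\<lambda>n. z ^ n *\<^sub>C (T ^^ n) x)" "norm (\<Sum>n. z ^ n *\<^sub>C (T ^^ n) x) \<le> C * norm x / (1 - cmod z)"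
proof -
  have geo: "(\<lambda>n. C * norm x * cmod z ^ n) sums (C * norm x * (1 / (1 - cmod z)))"
    by (intro sums_mult geometric_sums) (use assms in simp)
  have le: "norm (z ^ n *\<^sub>C (T ^^ n) x) \<le> C * norm x * cmod z ^ n" for n
    using mult_left_mono[OF power_bounded[of n x], of "cmod z ^ n"]
    by (simp add: norm_scaleC norm_power mult_ac)
  have sn: "summable (\<lambda>n. norm (z ^ n *\<^sub>C (T ^^ n) x))"
    by (rule summable_comparison_test'[OF sums_summable[OF geo], of 0]) (simp add: le)
  then show "summable (\<lambda>n. z ^ n *\<^sub>C (T ^^ n) x)"
    by (rule summable_norm_cancel)
  have "norm (\<Sum>n. z ^ n *\<^sub>C (T ^^ n) x) \<le> (\<Sum>n. C * norm x * cmod z ^ n)"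
    by (rule order_trans[OF summable_norm[OF sn] suminf_le[OF le sn sums_summable[OF geo]]])
  then show "norm (\<Sum>n. z ^ n *\<^sub>C (T ^^ n) x) \<le> C * norm x / (1 - cmod z)"
    using sums_unique[OF geo] by simp
qed

lemma inj_one_minus:
  assumes "cmod z < 1"
  shows "inj (\<lambda>x. x - z *\<^sub>C T x)"
proof (rule injI)
  fix x y
  assume eq: "x - z *\<^sub>C T x = y - z *\<^sub>C T y"
  define d where "d = x - y"
  have d: "d = z *\<^sub>C T d"
    using eq by (simp add: d_def bounded_clinearD[OF T] scaleC_diff_right algebra_simps)
  have dn: "d = z ^ n *\<^sub>C (T ^^ n) d" for n
  proof (induction n)
    case 0
    show ?case
      by (simp add: scaleC_one)
  next
    case (Suc n)
    have "d = z *\<^sub>C T (z ^ n *\<^sub>C (T ^^ n) d)"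
      using d Suc by simp
    then show ?case
      by (simp add: bounded_clinearD[OF T] scaleC_scaleC)
  qed
  have "norm d \<le> cmod z ^ n * (C * norm d)" for n
    using mult_left_mono[OF power_bounded[of n d], of "cmod z ^ n"] arg_cong[OF dn[of n], of norm]
    by (simp add: norm_scaleC norm_power)
  moreover have "(\<lambda>n. cmod z ^ n * (C * norm d)) \<longlonglongrightarrow> 0 * (C * norm d)"
    by (intro tendsto_intros LIMSEQ_power_zero) (use assms in simp)
  ultimately have "norm d \<le> 0 * (C * norm d)"
    by (intro LIMSEQ_le_const) auto
  then show "x = y"
    by (simp add: d_def)
qed

lemma one_minus_neumann:
  assumes "cmod z < 1"
  shows "(\<Sum>n. z ^ n *\<^sub>C (T ^^ n) x) - z *\<^sub>C T (\<Sum>n. z ^ n *\<^sub>C (T ^^ n) x) = x"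
proof -
  let ?f = "\<lambda>n. z ^ n *\<^sub>C (T ^^ n) x"
  have bl: "bounded_linear (\<lambda>x. z *\<^sub>C T x)"
    using bounded_linear_compose[OF bounded_linear_scaleC bounded_clinearD(5)[OF T]] by simp
  have "z *\<^sub>C T (\<Sum>n. ?f n) = (\<Sum>n. z *\<^sub>C T (?f n))"
    by (rule bounded_linear.suminf[OF bl neumann_summable(1)[OF assms]])
  also have "(\<lambda>n. z *\<^sub>C T (?f n)) = (\<lambda>n. ?f (Suc n))"
    by (simp add: bounded_clinearD[OF T] scaleC_scaleC)
  also have "(\<Sum>n. ?f (Suc n)) = (\<Sum>n. ?f n) - ?f 0"
    by (rule suminf_split_head[OF neumann_summable(1)[OF assms]])
  finally show ?thesis
    by (simp add: scaleC_one)
qed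

lemma resolvent_eq_neumann:
  assumes "cmod z < 1"
  shows "resolvent T z x = (\<Sum>n. z ^ n *\<^sub>C (T ^^ n) x)"
  unfolding resolvent_def
  by (rule inv_f_eq[OF inj_one_minus[OF assms] one_minus_neumann[OF assms]])

lemma resolvent_right_inverse:
  assumes "cmod z < 1"
  shows "resolvent T z x - z *\<^sub>C T (resolvent T z x) = x"
  by (simp add: resolvent_eq_neumann[OF assms] one_minus_neumann[OF assms])

lemma resolvent_left_inverse:
  assumes "cmod z < 1"
  shows "resolvent T z (x - z *\<^sub>C T x) = x"
  unfolding resolvent_def by (rule inv_f_f[OF inj_one_minus[OF assms]])

lemma bounded_clinear_resolvent:
  assumes z: "cmod z < 1"
  shows "bounded_clinear (resolvent T z)"
proof -
  have eqI: "resolvent T z y = x" if "x - z *\<^sub>C T x = y" for x y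
    using resolvent_left_inverse[OF z, of x] that by simp
  have add: "resolvent T z (x + y) = resolvent T z x + resolvent T z y" for x y
  proof (rule eqI)
    have "resolvent T z x + resolvent T z y - z *\<^sub>C T (resolvent T z x + resolvent T z y) =
        (resolvent T z x - z *\<^sub>C T (resolvent T z x)) +
        (resolvent T z y - z *\<^sub>C T (resolvent T z y))"
      by (simp add: bounded_clinearD(1)[OF T] scaleC_add_right)
    then show "resolvent T z x + resolvent T z y - z *\<^sub>C T (resolvent T z x + resolvent T z y) = x + y"
      by (simp only: resolvent_right_inverse[OF z])
  qed
  have scale: "resolvent T z (c *\<^sub>C x) = c *\<^sub>C resolvent T z x" for c x
  proof (rule eqI)
    have "c *\<^sub>C resolvent T z x - z *\<^sub>C T (c *\<^sub>C resolvent T z x) =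
        c *\<^sub>C (resolvent T z x - z *\<^sub>C T (resolvent T z x))"
      by (simp add: bounded_clinearD[OF T] scaleC_diff_right scaleC_scaleC mult.commute)
    then show "c *\<^sub>C resolvent T z x - z *\<^sub>C T (c *\<^sub>C resolvent T z x) = c *\<^sub>C x"
      by (simp only: resolvent_right_inverse[OF z])
  qed
  have "bounded_linear (resolvent T z)"
  proof (rule bounded_linear_intro)
    show "norm (resolvent T z x) \<le> norm x * (C / (1 - cmod z))" for x
      using neumann_summable(2)[OF z, of x] by (simp add: resolvent_eq_neumann[OF z] mult.commute)
    show "resolvent T z (r *\<^sub>R x) = r *\<^sub>R resolvent T z x" for r x
      by (simp only: scaleC_of_real[symmetric] scale)
  qed (rule add)
  with scale show ?thesis
    by (simp add: bounded_clinear_def)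
qed

text \<open>
  The adjoint of \<open>(I - z T)\<^sup>-\<^sup>1\<close> inverts the adjoint of \<open>I - z T\<close>, hence is the resolvent of \<open>T\<^sup>*\<close>.
\<close>

lemma cinner_resolvent_cadjoint:
  assumes z: "cmod z < 1"
  shows "cinner x (resolvent (cadjoint T) (cnj z) y) = cinner (resolvent T z x) y"
proof -
  let ?R = "cadjoint (resolvent T z)"
  note adj = cinner_cadjoint[OF bounded_clinear_resolvent[OF z]] cinner_cadjoint[OF T]
  have right: "?R y - cnj z *\<^sub>C cadjoint T (?R y) = y" for y
    by (rule cinner_ext)
      (simp add: cinner_diff_right cinner_scaleC_right adj[symmetric]
        cinner_scaleC_left[symmetric] cinner_diff_left[symmetric]
        bounded_clinearD(2,3)[OF bounded_clinear_resolvent[OF z], symmetric] resolvent_left_inverse[OF z])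
  have "inj (\<lambda>y. y - cnj z *\<^sub>C cadjoint T y)"
  proof (rule injI)
    fix u v
    assume eq: "u - cnj z *\<^sub>C cadjoint T u = v - cnj z *\<^sub>C cadjoint T v"
    have left: "cinner (resolvent T z x) (w - cnj z *\<^sub>C cadjoint T w) = cinner x w" for x w
      by (simp add: cinner_diff_right cinner_scaleC_right adj(2)[symmetric]
        cinner_scaleC_left[symmetric] cinner_diff_left[symmetric] resolvent_right_inverse[OF z])
    show "u = v"
      by (rule cinner_ext) (metis left eq)
  qed
  then have "resolvent (cadjoint T) (cnj z) y = ?R y"
    unfolding resolvent_def[of "cadjoint T"] by (rule inv_f_eq) (rule right)
  then show ?thesis
    by (simp add: adj(1))
qed

end

section \<open>Output-stable pairs\<close>

lemma obs_op_vanishes: "z \<notin> \<bbbD> \<Longrightarrow> obs_op E T x z = 0"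
  by (simp only: obs_op_def on_disk_def if_False)

lemma taylor_coeff_obs_op:
  fixes T :: "'x::complex_hilbert_space \<Rightarrow> 'x"
  assumes T: "bounded_clinear T" and E: "bounded_clinear E"
  shows "taylor_coeff (obs_op E T x) n = E ((T ^^ n) x)"
proof -
  obtain K where K: "K > 0" "\<And>x. norm (T x) \<le> norm x * K"
    using bounded_clinearD(4)[OF T] by blast
  obtain L where L: "L > 0" "\<And>x. cmod (E x) \<le> norm x * L"
    using bounded_clinearD(4)[OF E] by blast
  have Tn: "norm ((T ^^ n) x) \<le> norm x * K ^ n" for n
  proof (induction n)
    case (Suc n)
    then show ?case
      using order_trans[OF K(2)[of "(T ^^ n) x"] mult_right_mono[OF Suc, of K]] K(1)
      by (simp add: mult_ac)
  qed simp
  \<comment> \<open>A radius that is at most 1, to stay in the disk, and at most \<open>1 / \<parallel>T\<parallel>\<close>, for convergence.\<close>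
  define r where "r = 1 / (K + 1)"
  have r: "r > 0" "r < 1" "r * K < 1"
    using K(1) by (simp_all add: r_def)
  show ?thesis
  proof (rule taylor_coeff_power_series[OF r(1)])
    fix z :: complex
    assume z: "cmod z < r"
    have "summable (\<lambda>n. E ((T ^^ n) x) * z ^ n)"
    proof (rule summable_comparison_test')
      show "summable (\<lambda>n. norm x * L * (r * K) ^ n)"
        using r K(1) by (intro summable_mult summable_geometric) simp
      show "norm (E ((T ^^ n) x) * z ^ n) \<le> norm x * L * (r * K) ^ n" for n
      proof -
        have "cmod (E ((T ^^ n) x)) \<le> norm x * K ^ n * L"
          using order_trans[OF L(2) mult_right_mono[OF Tn]] L(1) by simp
        moreover have "cmod z ^ n \<le> r ^ n"
          using z by (intro power_mono) simp_all
        ultimately have "cmod (E ((T ^^ n) x)) * cmod z ^ n \<le> (norm x * K ^ n * L) * r ^ n"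
          by (rule mult_mono) (use K L in simp_all)
        then show ?thesis
          by (simp add: norm_mult norm_power power_mult_distrib mult_ac)
      qed
    qed
    then show "(\<lambda>n. E ((T ^^ n) x) * z ^ n) sums obs_op E T x z"
      using z r by (simp add: obs_op_def on_disk_def sums_iff mult.commute)
  qed
qed

locale output_stable_pair =
  fixes E :: "'x::complex_hilbert_space \<Rightarrow> complex" and T :: "'x \<Rightarrow> 'x"
  assumes T: "bounded_clinear T" and E: "bounded_clinear E" and stable: "output_stable E T"
begin

lemma obs_mem: "obs_op E T x \<in> hardy2"
  using stable by (simp add: output_stable_def)

lemma obs_coeff: "taylor_coeff (obs_op E T x) n = E ((T ^^ n) x)"
  by (rule taylor_coeff_obs_op[OF T E])

lemma obs_bounded: obtains C where "\<And>x. ip_norm hardy2_inner (obs_op E T x) \<le> C * norm x"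
  using stable by (auto simp: output_stable_def hardy2_norm_eq)

lemma obs_add: "obs_op E T (x + y) = (\<lambda>z. obs_op E T x z + obs_op E T y z)"
  by (rule hardy2_eqI)
    (simp_all add: obs_mem hardy2_add taylor_coeff_add hardy2_holomorphic obs_coeff
      bounded_clinearD(1)[OF bounded_clinear_funpow[OF T]] bounded_clinearD(1)[OF E])

lemma obs_scale: "obs_op E T (c *\<^sub>C x) = (\<lambda>z. c * obs_op E T x z)"
  by (rule hardy2_eqI)
    (simp_all add: obs_mem hardy2_cmult taylor_coeff_cmult hardy2_holomorphic obs_coeff
      bounded_clinearD(3)[OF bounded_clinear_funpow[OF T]] bounded_clinearD(3)[OF E]
      scaleC_complex_def)

lemma cinner_obs_adj:
  assumes f: "f \<in> hardy2"
  shows "cinner x (obs_adj E T f) = hardy2_inner (obs_op E T x) f"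
proof -
  obtain C where C: "\<And>x. ip_norm hardy2_inner (obs_op E T x) \<le> C * norm x"
    using obs_bounded by blast
  have "\<exists>!v. \<forall>x. cinner x v = hardy2_inner (obs_op E T x) f"
  proof (rule riesz_representation)
    show "cmod (hardy2_inner (obs_op E T x) f) \<le> (C * ip_norm hardy2_inner f) * norm x" for x
      using order_trans[OF hardy2.cauchy_schwarz[OF obs_mem f]
          mult_right_mono[OF C hardy2.norm_nonneg[OF f]]]
      by (simp add: mult_ac)
  qed (simp_all add: obs_add obs_scale obs_mem f hardy2.ip_add_left hardy2.ip_scale_left)
  from theI'[OF this] show ?thesis
    unfolding obs_adj_def by blast
qed

lemma tangential_value_eq_obs_adj:
  assumes f: "f \<in> hardy2"
  shows "tangential_value f T E = obs_adj E T f"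
  unfolding tangential_value_def
proof (rule the_equality)
  have sums: "(\<lambda>n. cinner (taylor_coeff f n *\<^sub>C (cadjoint T ^^ n) (adjoint_vec E)) x)
      sums cinner (obs_adj E T f) x" for x
  proof -
    have "cinner (taylor_coeff f n *\<^sub>C (cadjoint T ^^ n) (adjoint_vec E)) x =
        taylor_coeff f n * cnj (taylor_coeff (obs_op E T x) n)" for n
    proof -
      have "cinner x ((cadjoint T ^^ n) (adjoint_vec E)) = E ((T ^^ n) x)"
        by (simp only: cinner_cadjoint_power[OF T] cinner_adjoint_vec[OF E])
      then show ?thesis
        by (simp only: cinner_commute[of _ x] cinner_scaleC_right complex_cnj_mult complex_cnj_cnj obs_coeff)
    qed
    moreover have "hardy2_inner f (obs_op E T x) = cinner (obs_adj E T f) x"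
      by (simp only: hardy2.ip_commute[OF f obs_mem] cinner_obs_adj[OF f, symmetric]
          cinner_commute[of "obs_adj E T f"])
    ultimately show ?thesis
      using hardy2_inner_sums[OF f obs_mem[of x]] by simp
  qed
  then show "\<forall>x. (\<lambda>n. cinner (taylor_coeff f n *\<^sub>C (cadjoint T ^^ n) (adjoint_vec E)) x)
      sums cinner (obs_adj E T f) x"
    by blast
  fix v
  assume v: "\<forall>x. (\<lambda>n. cinner (taylor_coeff f n *\<^sub>C (cadjoint T ^^ n) (adjoint_vec E)) x) sums cinner v x"
  show "v = obs_adj E T f"
  proof (rule cinner_ext)
    fix x
    have "cinner v x = cinner (obs_adj E T f) x"
      using sums_unique2[OF v[rule_format] sums] .
    then show "cinner x v = cinner x (obs_adj E T f)"
      by (simp only: cinner_commute[of x])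
  qed
qed

text \<open>
  Applying \<open>T\<close> drops the leading Taylor coefficient: \<open>T\<close> acts as the backward shift, a contraction of the
  Hardy space. If the observability operator is bounded below, \<open>T\<close> is therefore power bounded.
\<close>

lemma obs_shift_le:
  "ip_norm hardy2_inner (obs_op E T ((T ^^ n) x)) \<le> ip_norm hardy2_inner (obs_op E T x)"
proof (rule power2_le_imp_le)
  let ?a = "\<lambda>k. (cmod (E ((T ^^ k) x)))\<^sup>2"
  have sm: "summable ?a"
    using hardy2_square_summable[OF obs_mem[of x]] by (simp only: obs_coeff)
  have "(ip_norm hardy2_inner (obs_op E T ((T ^^ n) x)))\<^sup>2 = (\<Sum>k. ?a (k + n))"
    by (simp add: hardy2_norm_square(1)[OF obs_mem] obs_coeff funpow_add)
  also have "\<dots> \<le> (\<Sum>k. ?a k)"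
    using suminf_split_initial_segment[OF sm, of n] by (simp add: sum_nonneg)
  also have "\<dots> = (ip_norm hardy2_inner (obs_op E T x))\<^sup>2"
    by (simp add: hardy2_norm_square(1)[OF obs_mem] obs_coeff)
  finally show "(ip_norm hardy2_inner (obs_op E T ((T ^^ n) x)))\<^sup>2 \<le> (ip_norm hardy2_inner (obs_op E T x))\<^sup>2" .
qed (rule hardy2.norm_nonneg[OF obs_mem])

lemma power_bounded_if_bounded_below:
  assumes below: "\<And>x. norm x \<le> B * ip_norm hardy2_inner (obs_op E T x)"
  obtains C where "\<And>n x. norm ((T ^^ n) x) \<le> C * norm x"
proof -
  obtain C where C: "\<And>x. ip_norm hardy2_inner (obs_op E T x) \<le> C * norm x"
    using obs_bounded by blast
  have "norm ((T ^^ n) x) \<le> (\<bar>B\<bar> * C) * norm x" for n x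
  proof -
    have "norm ((T ^^ n) x) \<le> \<bar>B\<bar> * ip_norm hardy2_inner (obs_op E T ((T ^^ n) x))"
      using below[of "(T ^^ n) x"] hardy2.norm_nonneg[OF obs_mem, of "(T ^^ n) x"]
      by (meson abs_ge_self mult_right_mono order_trans)
    also have "\<dots> \<le> \<bar>B\<bar> * ip_norm hardy2_inner (obs_op E T x)"
      by (rule mult_left_mono[OF obs_shift_le abs_ge_zero])
    also have "\<dots> \<le> \<bar>B\<bar> * (C * norm x)"
      by (rule mult_left_mono[OF C abs_ge_zero])
    finally show ?thesis
      by (simp add: mult.assoc)
  qed
  with that show ?thesis
    by blast
qed

end

lemma obs_op_resolvent:
  fixes T :: "'x::complex_hilbert_space \<Rightarrow> 'x"
  assumes T: "bounded_clinear T" and E: "bounded_clinear E"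
    and pb: "\<And>n x. norm ((T ^^ n) x) \<le> C * norm x" and z: "z \<in> \<bbbD>"
  shows "E (resolvent T z x) = obs_op E T x z"
proof -
  have z1: "cmod z < 1"
    using z by simp
  have "E (resolvent T z x) = (\<Sum>n. E (z ^ n *\<^sub>C (T ^^ n) x))"
    unfolding resolvent_eq_neumann[OF T pb z1]
    by (rule bounded_linear.suminf[OF bounded_clinearD(5)[OF E] neumann_summable(1)[OF T pb z1]])
  then show ?thesis
    using z by (simp add: obs_op_def on_disk_def bounded_clinearD(3)[OF E] scaleC_complex_def)
qed

section \<open>De Branges--Rovnyak spaces\<close>

locale schur_rkhs = reproducing_kernel_hilbert_space "\<bbbD>" "dbr_kernel s" Hs ips
  for s Hs ips +
  assumes schur: "s \<in> schur_class"
begin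

lemma schur_holomorphic: "s holomorphic_on \<bbbD>"
  and schur_vanishes: "z \<notin> \<bbbD> \<Longrightarrow> s z = 0"
  using schur unfolding schur_class_def by blast+

lemma dbr_kernel_eq:
  "dbr_kernel s = (\<lambda>z w. szego_kernel z w - s z * szego_kernel z w * cnj (s w))"
  by (simp add: fun_eq_iff dbr_kernel_def szego_kernel_def diff_divide_distrib)

lemma dbr_form:
  "kernel_form (dbr_kernel s) W c =
    kernel_form szego_kernel W c - kernel_form szego_kernel W (\<lambda>w. c w * cnj (s w))"
  by (simp only: dbr_kernel_eq kernel_form_diff kernel_form_multiplier)

text \<open>
  The de Branges--Rovnyak kernel is the Szego kernel \<open>k\<close> minus \<open>s k s\<^sup>*\<close>. Since it reproduces a space
  it is positive, that is \<open>s k s\<^sup>* \<le> k\<close>: multiplication by \<open>s\<close> contracts the Hardy space, and applied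
  to the constant 1 this shows that \<open>s\<close> itself lies there. Conversely \<open>s k s\<^sup>* \<ge> 0\<close> gives
  contractive inclusion in the Hardy space.
\<close>

lemma schur_mult:
  assumes f: "f \<in> hardy2"
  shows "(\<lambda>z. s z * f z) \<in> hardy2"
    and "ip_norm hardy2_inner (\<lambda>z. s z * f z) \<le> ip_norm hardy2_inner f"
proof -
  have "(\<lambda>z. s z * f z) \<in> hardy2 \<and>
      ip_norm hardy2_inner (\<lambda>z. s z * f z) \<le> \<bar>ip_norm hardy2_inner f\<bar>"
  proof (rule hardy2.mem_if_kernel_bound)
    fix W :: "complex set" and c
    assume W: "finite W" "W \<subseteq> \<bbbD>"
    have "(cmod (\<Sum>w\<in>W. (c w * cnj (s w)) * cnj (f w)))\<^sup>2 \<le>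
        (ip_norm hardy2_inner f)\<^sup>2 * Re (kernel_form szego_kernel W (\<lambda>w. c w * cnj (s w)))"
      by (rule hardy2.kernel_bound[OF f W(2)])
    also have "\<dots> \<le> (ip_norm hardy2_inner f)\<^sup>2 * Re (kernel_form szego_kernel W c)"
    proof (rule mult_left_mono)
      have "0 \<le> Re (kernel_form (dbr_kernel s) W c)"
        using positive_kernel W unfolding positive_kernel_def by blast
      then show "Re (kernel_form szego_kernel W (\<lambda>w. c w * cnj (s w))) \<le>
          Re (kernel_form szego_kernel W c)"
        by (simp add: dbr_form)
    qed simp
    finally show "(cmod (\<Sum>w\<in>W. c w * cnj (s w * f w)))\<^sup>2 \<le>
        (ip_norm hardy2_inner f)\<^sup>2 * Re (kernel_form szego_kernel W c)"
      by (simp add: mult.assoc)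
  qed (metis schur_vanishes mult_zero_left)
  then show "(\<lambda>z. s z * f z) \<in> hardy2"
    and "ip_norm hardy2_inner (\<lambda>z. s z * f z) \<le> ip_norm hardy2_inner f"
    using hardy2.norm_nonneg[OF f] by simp_all
qed

lemma schur_mem_hardy2: "s \<in> hardy2"
proof -
  have "(\<lambda>z. s z * on_disk (\<lambda>z. z ^ 0) z) = s"
    using schur_vanishes by (auto simp: fun_eq_iff on_disk_def)
  then show ?thesis
    using schur_mult(1)[OF on_disk_power_mem[of 0]] by simp
qed

lemma contained_in_hardy2:
  assumes f: "f \<in> Hs"
  shows "f \<in> hardy2" "ip_norm hardy2_inner f \<le> ip_norm ips f"
proof -
  have "f \<in> hardy2 \<and> ip_norm hardy2_inner f \<le> \<bar>ip_norm ips f\<bar>"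
  proof (rule hardy2.mem_if_kernel_bound)
    fix W :: "complex set" and c
    assume W: "finite W" "W \<subseteq> \<bbbD>"
    have "0 \<le> Re (kernel_form szego_kernel W (\<lambda>w. c w * cnj (s w)))"
      using hardy2.positive_kernel W unfolding positive_kernel_def by blast
    then have "(ip_norm ips f)\<^sup>2 * Re (kernel_form (dbr_kernel s) W c) \<le>
        (ip_norm ips f)\<^sup>2 * Re (kernel_form szego_kernel W c)"
      by (intro mult_left_mono) (simp_all add: dbr_form)
    with kernel_bound[OF f W(2), of c]
    show "(cmod (\<Sum>w\<in>W. c w * cnj (f w)))\<^sup>2 \<le>
        (ip_norm ips f)\<^sup>2 * Re (kernel_form szego_kernel W c)"
      by linarith
  qed (rule vanishes_outside[OF f])
  then show "f \<in> hardy2" "ip_norm hardy2_inner f \<le> ip_norm ips f"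
    using norm_nonneg[OF f] by simp_all
qed

lemma kernel_fun_eq:
  assumes w: "w \<in> \<bbbD>"
  shows "kernel_fun w = (\<lambda>z. hardy2.kernel_fun w z - cnj (s w) * (s z * hardy2.kernel_fun w z))"
  by (auto simp: fun_eq_iff dbr_kernel_eq mult_ac)

lemma schur_mult_adjoint:
  obtains A where "\<And>g. g \<in> hardy2 \<Longrightarrow> A g \<in> hardy2"
    "\<And>f g. f \<in> hardy2 \<Longrightarrow> g \<in> hardy2 \<Longrightarrow> hardy2_inner f (A g) = hardy2_inner (\<lambda>z. s z * f z) g"
proof (rule bounded_adjoint[OF hardy2.function_hilbert_space_axioms hardy2.function_hilbert_space_axioms,
    of "\<lambda>f z. s z * f z" 1])
  show "ip_norm hardy2_inner (\<lambda>z. s z * f z) \<le> 1 * ip_norm hardy2_inner f" if "f \<in> hardy2" for f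
    using schur_mult(2)[OF that] by simp
qed (auto simp: schur_mult(1) distrib_left mult.left_commute)

text \<open>
  With \<open>M\<close> for multiplication by \<open>s\<close> on the Hardy space, the adjoint of the inclusion is \<open>g \<mapsto> g - s M\<^sup>*g\<close>,
  as pairing \<open>g\<close> with the kernel functions shows. The function \<open>h\<close> stands for \<open>M\<^sup>*g\<close>.
\<close>

lemma inclusion_adjoint:
  assumes g: "g \<in> hardy2" and h: "h \<in> hardy2"
    and adj: "\<And>f. f \<in> hardy2 \<Longrightarrow> hardy2_inner f h = hardy2_inner (\<lambda>z. s z * f z) g"
  shows "(\<lambda>z. g z - s z * h z) \<in> Hs"
    and "\<And>f. f \<in> Hs \<Longrightarrow> ips f (\<lambda>z. g z - s z * h z) = hardy2_inner f g"
proof -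
  obtain B where B: "\<And>g. g \<in> hardy2 \<Longrightarrow> B g \<in> Hs"
      "\<And>f g. f \<in> Hs \<Longrightarrow> g \<in> hardy2 \<Longrightarrow> ips f (B g) = hardy2_inner f g"
  proof (rule bounded_adjoint[OF function_hilbert_space_axioms hardy2.function_hilbert_space_axioms,
      of "\<lambda>f. f" 1])
    show "ip_norm hardy2_inner f \<le> 1 * ip_norm ips f" if "f \<in> Hs" for f
      using contained_in_hardy2(2)[OF that] by simp
  qed (auto simp: contained_in_hardy2(1))
  have "B g w = g w - s w * h w" for w
  proof (cases "w \<in> \<bbbD>")
    case True
    let ?k = "hardy2.kernel_fun w"
    have k: "?k \<in> hardy2"
      by (rule hardy2.kernel_mem[OF True])
    have "cnj (B g w) = ips (kernel_fun w) (B g)"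
      by (rule ip_kernel_left[OF True B(1)[OF g], symmetric])
    also have "\<dots> = hardy2_inner (kernel_fun w) g"
      by (rule B(2)[OF kernel_mem[OF True] g])
    also have "\<dots> = hardy2_inner ?k g - cnj (s w) * hardy2_inner (\<lambda>z. s z * ?k z) g"
      unfolding kernel_fun_eq[OF True]
      using k schur_mult(1)[OF k] g
      by (simp only: hardy2.ip_diff_left hardy2.ip_scale_left hardy2.scale_mem)
    also have "\<dots> = cnj (g w) - cnj (s w) * cnj (h w)"
      by (simp only: adj[OF k, symmetric] hardy2.ip_kernel_left[OF True g] hardy2.ip_kernel_left[OF True h])
    finally show ?thesis
      by (metis complex_cnj_cancel_iff complex_cnj_diff complex_cnj_mult)
  next
    case False
    then show ?thesis
      using vanishes_outside[OF B(1)[OF g]] hardy2_vanishes[OF g] schur_vanishes by simp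
  qed
  then have "B g = (\<lambda>z. g z - s z * h z)"
    by blast
  then show "(\<lambda>z. g z - s z * h z) \<in> Hs"
    and "\<And>f. f \<in> Hs \<Longrightarrow> ips f (\<lambda>z. g z - s z * h z) = hardy2_inner f g"
    using B g by metis+
qed

end

section \<open>Splitting a reproducing kernel\<close>

lemma (in function_hilbert_space) positive_kernel_gram:
  assumes "\<And>w. w \<in> D \<Longrightarrow> g w \<in> H"
  shows "positive_kernel D (\<lambda>z w. ip (g w) (g z))"
  unfolding positive_kernel_def
proof (intro allI impI)
  fix W c
  assume W: "finite W" "W \<subseteq> D"
  then have mem: "g w \<in> H" if "w \<in> W" for w
    using assms that by blast
  let ?k = "\<lambda>z. \<Sum>w\<in>W. c w * g w z"
  have kH: "?k \<in> H"
    by (rule sum_mem) (rule mem)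
  have "ip ?k ?k = (\<Sum>z\<in>W. cnj (c z) * ip ?k (g z))"
    by (rule ip_sum_right[OF mem kH])
  also have "\<dots> = (\<Sum>z\<in>W. cnj (c z) * (\<Sum>w\<in>W. c w * ip (g w) (g z)))"
    by (intro sum.cong refl) (simp add: ip_sum_left[OF mem mem])
  also have "\<dots> = kernel_form (\<lambda>z w. ip (g w) (g z)) W c"
    by (simp add: kernel_form_def sum_distrib_left mult_ac)
  finally show "0 \<le> Re (kernel_form (\<lambda>z w. ip (g w) (g z)) W c)"
    using ip_nonneg[OF kH] by simp
qed

text \<open>
  Setting for a kernel of the form \<open>K = m L m\<^sup>* + F Q F\<^sup>*\<close>. The operator \<open>F\<close> maps an abstract space into
  the space of \<open>K\<close>; \<open>v\<close> is its adjoint, \<open>Q\<close> the inverse of \<open>F\<^sup>*F\<close>, and \<open>e w\<close> represents evaluation of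
  \<open>F x\<close> at \<open>w\<close>. In this situation the space of \<open>K\<close> is the orthogonal sum of the range of \<open>F\<close> and of an
  isometric copy, under multiplication by \<open>m\<close>, of the space of \<open>L\<close>.
\<close>

locale kernel_splitting =
  big: reproducing_kernel_hilbert_space D K H ip +
  small: reproducing_kernel_hilbert_space D L G ipG
  for D :: "'z set" and K H ip L G ipG +
  fixes m :: "'z \<Rightarrow> complex"
    and F :: "'x::complex_hilbert_space \<Rightarrow> 'z \<Rightarrow> complex"
    and v :: "('z \<Rightarrow> complex) \<Rightarrow> 'x"
    and Q :: "'x \<Rightarrow> 'x"
    and e :: "'z \<Rightarrow> 'x"
  assumes F_mem: "F x \<in> H"
    and ip_F: "f \<in> H \<Longrightarrow> ip f (F x) = cinner (v f) x"
    and F_eval: "w \<in> D \<Longrightarrow> F x w = cinner x (e w)"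
    and Q_left: "Q (v (F x)) = x"
    and Q_right: "v (F (Q x)) = x"
    and kernel_split: "z \<in> D \<Longrightarrow> w \<in> D \<Longrightarrow> K z w = m z * L z w * cnj (m w) + F (Q (e w)) z"
    and mult_inj: "h \<in> G \<Longrightarrow> (\<lambda>z. m z * h z) = (\<lambda>z. 0) \<Longrightarrow> h = (\<lambda>z. 0)"
begin

lemma Q_self_adjoint: "cinner (Q x) y = cinner x (Q y)"
proof -
  have "cinner (Q x) y = cnj (cinner (v (F (Q y))) (Q x))"
    unfolding Q_right by (rule cinner_commute)
  also have "\<dots> = cnj (ip (F (Q y)) (F (Q x)))"
    by (simp only: ip_F[OF F_mem])
  also have "\<dots> = ip (F (Q x)) (F (Q y))"
    by (rule big.ip_commute[OF F_mem F_mem, symmetric])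
  also have "\<dots> = cinner x (Q y)"
    by (simp only: ip_F[OF F_mem] Q_right)
  finally show ?thesis .
qed

lemma F_kernel_gram: "w \<in> D \<Longrightarrow> z \<in> D \<Longrightarrow> F (Q (e w)) z = ip (F (Q (e w))) (F (Q (e z)))"
  by (simp only: F_eval ip_F[OF F_mem] Q_right Q_self_adjoint)

lemma F_zero: "F 0 = (\<lambda>z. 0)"
proof
  show "F 0 z = 0" for z
    by (cases "z \<in> D") (simp_all add: F_eval big.vanishes_outside[OF F_mem])
qed

text \<open>
  \<open>K - m L m\<^sup>*\<close> is the Gram kernel of the functions \<open>F (Q (e w))\<close>, hence positive, so that the
  membership criterion makes multiplication by \<open>m\<close> a contraction.
\<close>

lemma mult_mem:
  assumes h: "h \<in> G"
  shows "(\<lambda>z. m z * h z) \<in> H" "ip_norm ip (\<lambda>z. m z * h z) \<le> ip_norm ipG h"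
proof -
  have "(\<lambda>z. m z * h z) \<in> H \<and> ip_norm ip (\<lambda>z. m z * h z) \<le> \<bar>ip_norm ipG h\<bar>"
  proof (rule big.mem_if_kernel_bound)
    show "m z * h z = 0" if "z \<notin> D" for z
      using small.vanishes_outside[OF h that] by simp
    fix W c
    assume W: "finite W" "W \<subseteq> D"
    have "kernel_form K W c =
        kernel_form L W (\<lambda>w. c w * cnj (m w)) + kernel_form (\<lambda>z w. ip (F (Q (e w))) (F (Q (e z)))) W c"
    proof -
      have "kernel_form K W c =
          kernel_form (\<lambda>z w. m z * L z w * cnj (m w) - - ip (F (Q (e w))) (F (Q (e z)))) W c"
        unfolding kernel_form_def using W
        by (intro sum.cong refl) (simp add: kernel_split F_kernel_gram[symmetric] subset_iff)
      also have "\<dots> = kernel_form L W (\<lambda>w. c w * cnj (m w)) -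
          kernel_form (\<lambda>z w. - ip (F (Q (e w))) (F (Q (e z)))) W c"
        by (simp only: kernel_form_diff kernel_form_multiplier)
      finally show ?thesis
        by (simp add: kernel_form_def sum_negf)
    qed
    moreover have "0 \<le> Re (kernel_form (\<lambda>z w. ip (F (Q (e w))) (F (Q (e z)))) W c)"
      using big.positive_kernel_gram[of "\<lambda>w. F (Q (e w))"] F_mem W
      unfolding positive_kernel_def by blast
    ultimately have "(ip_norm ipG h)\<^sup>2 * Re (kernel_form L W (\<lambda>w. c w * cnj (m w)))
        \<le> (ip_norm ipG h)\<^sup>2 * Re (kernel_form K W c)"
      by (intro mult_left_mono) simp_all
    with small.kernel_bound[OF h W(2), of "\<lambda>w. c w * cnj (m w)"]
    show "(cmod (\<Sum>w\<in>W. c w * cnj (m w * h w)))\<^sup>2 \<le> (ip_norm ipG h)\<^sup>2 * Re (kernel_form K W c)"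
      by (simp add: mult.assoc)
  qed
  then show "(\<lambda>z. m z * h z) \<in> H" "ip_norm ip (\<lambda>z. m z * h z) \<le> ip_norm ipG h"
    using small.norm_nonneg[OF h] by simp_all
qed

text \<open>
  Read as operators, the splitting of the kernel says \<open>I = F Q F\<^sup>* + M M\<^sup>*\<close> with \<open>M\<close> for multiplication
  by \<open>m\<close>; the proof evaluates both sides at a point by pairing with kernel functions.
\<close>

lemma mult_adjoint:
  obtains A where "\<And>f. f \<in> H \<Longrightarrow> A f \<in> G"
    "\<And>h f. h \<in> G \<Longrightarrow> f \<in> H \<Longrightarrow> ipG h (A f) = ip (\<lambda>z. m z * h z) f"
    "\<And>f. f \<in> H \<Longrightarrow> f = (\<lambda>z. F (Q (v f)) z + m z * A f z)"
proof -
  obtain A where A: "\<And>f. f \<in> H \<Longrightarrow> A f \<in> G"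
    "\<And>h f. h \<in> G \<Longrightarrow> f \<in> H \<Longrightarrow> ipG h (A f) = ip (\<lambda>z. m z * h z) f"
  proof (rule bounded_adjoint[OF small.function_hilbert_space_axioms big.function_hilbert_space_axioms,
      of "\<lambda>h z. m z * h z" 1])
    show "ip_norm ip (\<lambda>z. m z * h z) \<le> 1 * ip_norm ipG h" if "h \<in> G" for h
      using mult_mem(2)[OF that] by simp
  qed (auto simp: mult_mem(1) distrib_left mult.left_commute)
  have "f w = F (Q (v f)) w + m w * A f w" if f: "f \<in> H" for f w
  proof (cases "w \<in> D")
    case True
    let ?g = "F (Q (e w))"
    let ?L = "small.kernel_fun w"
    have L: "?L \<in> G"
      by (rule small.kernel_mem[OF True])
    have "(\<lambda>z. cnj (m w) * (m z * ?L z)) = (\<lambda>z. big.kernel_fun w z - ?g z)"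
      using True by (auto simp: fun_eq_iff kernel_split big.vanishes_outside[OF F_mem])
    then have "cnj (m w) * ip (\<lambda>z. m z * ?L z) f = ip (\<lambda>z. big.kernel_fun w z - ?g z) f"
      using big.ip_scale_left[OF mult_mem(1)[OF L] f, of "cnj (m w)"] by simp
    also have "\<dots> = cnj (f w) - cnj (ip f ?g)"
      by (simp only: big.ip_diff_left[OF big.kernel_mem[OF True] F_mem f]
          big.ip_kernel_left[OF True f] big.ip_commute[OF F_mem f])
    also have "ip f ?g = F (Q (v f)) w"
      by (simp only: ip_F[OF f] Q_self_adjoint[symmetric] F_eval[OF True])
    also have "ip (\<lambda>z. m z * ?L z) f = cnj (A f w)"
      by (simp only: A(2)[OF L f, symmetric] small.ip_kernel_left[OF True A(1)[OF f]])
    finally have "cnj (m w * A f w) = cnj (f w - F (Q (v f)) w)"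
      by simp
    then show ?thesis
      by (simp only: complex_cnj_cancel_iff) simp
  next
    case False
    then show ?thesis
      using big.vanishes_outside[OF f] big.vanishes_outside[OF F_mem]
        small.vanishes_outside[OF A(1)[OF f]] by simp
  qed
  then have "f = (\<lambda>z. F (Q (v f)) z + m z * A f z)" if "f \<in> H" for f
    using that by blast
  with A that show ?thesis
    by blast
qed

text \<open>
  On the range of \<open>F\<close> the summand \<open>F Q F\<^sup>*\<close> is the identity, so \<open>M M\<^sup>*F = 0\<close>, and \<open>M\<^sup>*F = 0\<close> because
  \<open>M\<close> is injective.
\<close>

lemma mult_orthogonal:
  assumes h: "h \<in> G"
  shows "ip (F x) (\<lambda>z. m z * h z) = 0" "v (\<lambda>z. m z * h z) = 0"
proof -
  obtain A where A: "\<And>f. f \<in> H \<Longrightarrow> A f \<in> G"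
    "\<And>h f. h \<in> G \<Longrightarrow> f \<in> H \<Longrightarrow> ipG h (A f) = ip (\<lambda>z. m z * h z) f"
    "\<And>f. f \<in> H \<Longrightarrow> f = (\<lambda>z. F (Q (v f)) z + m z * A f z)"
    using mult_adjoint by blast
  have orth: "ip (\<lambda>z. m z * h z) (F x) = 0" for x
  proof -
    have "m z * A (F x) z = 0" for z
      using fun_cong[OF A(3)[OF F_mem[of x]], of z] by (simp add: Q_left)
    then have "A (F x) = (\<lambda>z. 0)"
      by (rule mult_inj[OF A(1)[OF F_mem] ext])
    then show ?thesis
      using A(2)[OF h F_mem[of x]] small.ip_zero_right[OF h] by simp
  qed
  then show "ip (F x) (\<lambda>z. m z * h z) = 0"
    using big.ip_commute[OF F_mem mult_mem(1)[OF h]] by simp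
  show "v (\<lambda>z. m z * h z) = 0"
  proof (rule cinner_ext)
    show "cinner x (v (\<lambda>z. m z * h z)) = cinner x 0" for x
      using orth[of x] ip_F[OF mult_mem(1)[OF h], of x] cinner_commute[of x "v (\<lambda>z. m z * h z)"]
      by simp
  qed
qed

text \<open>
  By orthogonality \<open>M M\<^sup>*M = M\<close>; cancelling the injective \<open>M\<close> leaves \<open>M\<^sup>*M = I\<close>.
\<close>

lemma mult_isometric:
  assumes h: "h \<in> G"
  shows "ip_norm ip (\<lambda>z. m z * h z) = ip_norm ipG h"
proof -
  obtain A where A: "\<And>f. f \<in> H \<Longrightarrow> A f \<in> G"
    "\<And>h f. h \<in> G \<Longrightarrow> f \<in> H \<Longrightarrow> ipG h (A f) = ip (\<lambda>z. m z * h z) f"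
    "\<And>f. f \<in> H \<Longrightarrow> f = (\<lambda>z. F (Q (v f)) z + m z * A f z)"
    using mult_adjoint by blast
  let ?f = "\<lambda>z. m z * h z"
  have f: "?f \<in> H"
    by (rule mult_mem(1)[OF h])
  have "Q 0 = 0"
    using Q_left[of 0] mult_orthogonal(2)[OF small.zero_mem] by (simp add: F_zero)
  then have "m z * (A ?f z - h z) = 0" for z
    using fun_cong[OF A(3)[OF f], of z] mult_orthogonal(2)[OF h]
    by (auto simp: F_zero)
  then have "(\<lambda>z. A ?f z - h z) = (\<lambda>z. 0)"
    by (rule mult_inj[OF small.diff_mem[OF A(1)[OF f] h] ext])
  then have "A ?f = h"
    by (simp add: fun_eq_iff)
  then have "ip ?f ?f = ipG h h"
    using A(2)[OF h f] by simp
  then show ?thesis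
    by (simp add: ip_norm_def)
qed

lemma solution_iff:
  "f \<in> H \<and> v f = x \<longleftrightarrow> (\<exists>h\<in>G. f = (\<lambda>z. F (Q x) z + m z * h z))"
proof
  obtain A where A: "\<And>f. f \<in> H \<Longrightarrow> A f \<in> G"
    "\<And>h f. h \<in> G \<Longrightarrow> f \<in> H \<Longrightarrow> ipG h (A f) = ip (\<lambda>z. m z * h z) f"
    "\<And>f. f \<in> H \<Longrightarrow> f = (\<lambda>z. F (Q (v f)) z + m z * A f z)"
    using mult_adjoint by blast
  show "\<exists>h\<in>G. f = (\<lambda>z. F (Q x) z + m z * h z)" if "f \<in> H \<and> v f = x"
    using A(1,3)[of f] that by blast
  assume "\<exists>h\<in>G. f = (\<lambda>z. F (Q x) z + m z * h z)"
  then obtain h where h: "h \<in> G" and f: "f = (\<lambda>z. F (Q x) z + m z * h z)"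
    by blast
  have fH: "f \<in> H"
    unfolding f by (rule big.add_mem[OF F_mem mult_mem(1)[OF h]])
  have "cinner (v f) y = cinner x y" for y
  proof -
    have "cinner (v f) y = ip f (F y)"
      by (rule ip_F[OF fH, symmetric])
    also have "\<dots> = ip (F (Q x)) (F y) + ip (\<lambda>z. m z * h z) (F y)"
      unfolding f by (rule big.ip_add_left[OF F_mem mult_mem(1)[OF h] F_mem])
    finally show ?thesis
      by (simp add: ip_F F_mem mult_mem(1) h Q_right mult_orthogonal(2))
  qed
  then have "cinner (v f) = cinner x"
    by (rule ext)
  then have "v f = x"
    by (rule injD[OF inj_cinner])
  with fH show "f \<in> H \<and> v f = x"
    by blast
qed

lemma solution_norm:
  assumes h: "h \<in> G"
  shows "complex_of_real ((ip_norm ip (\<lambda>z. F (Q x) z + m z * h z))\<^sup>2) =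
    cinner (Q x) x + complex_of_real ((ip_norm ipG h)\<^sup>2)"
proof -
  let ?f = "\<lambda>z. m z * h z"
  have f: "?f \<in> H"
    by (rule mult_mem(1)[OF h])
  have "(ip_norm ip (\<lambda>z. F (Q x) z + ?f z))\<^sup>2 = (ip_norm ip (F (Q x)))\<^sup>2 + (ip_norm ip ?f)\<^sup>2"
    using big.norm_square_add_scale[OF F_mem f, of "Q x" 1] mult_orthogonal(1)[OF h] by simp
  moreover have "complex_of_real ((ip_norm ip (F (Q x)))\<^sup>2) = cinner (Q x) x"
    by (simp only: big.ip_self[OF F_mem, symmetric] ip_F[OF F_mem] Q_right Q_self_adjoint)
  ultimately show ?thesis
    by (simp only: of_real_add mult_isometric[OF h])
qed

end

section \<open>The matrix function and its first row\<close>

lemma mat2_entries: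
  "mat2 a b c d $ 1 $ 1 = a" "mat2 a b c d $ 1 $ 2 = b"
  "mat2 a b c d $ 2 $ 1 = c" "mat2 a b c d $ 2 $ 2 = d"
  by (simp_all add: mat2_def)

lemma J_form_entry:
  fixes A B :: "complex ^ 2 ^ 2"
  shows "(A ** J_mat ** mat_adjoint B) $ i $ j = A $ i $ 1 * cnj (B $ j $ 1) - A $ i $ 2 * cnj (B $ j $ 2)"
  by (simp add: matrix_matrix_mult_def sum_2 J_mat_def mat2_entries mat_adjoint_def map_matrix_def
      transpose_def)

lemma J_mat_entries: "J_mat $ 1 $ 1 = 1" "J_mat $ 1 $ 2 = 0" "J_mat $ 2 $ 1 = 0" "J_mat $ 2 $ 2 = - 1"
  by (simp_all add: J_mat_def mat2_entries)

text \<open>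
  The hypothesis concerns rows. With rows \<open>(p, q)\<close> and \<open>(u, v)\<close>, eliminating \<open>q\<close> and \<open>v\<close> from the moduli of
  its entries yields the relation \<open>\<bar>p\<bar>\<^sup>2 = 1 + \<bar>u\<bar>\<^sup>2\<close> for the first column.
\<close>

lemma J_unitary_first_column:
  fixes L :: "complex ^ 2 ^ 2"
  assumes "L ** J_mat ** mat_adjoint L = J_mat"
  shows "cmod (L $ 2 $ 1) < cmod (L $ 1 $ 1)"
proof -
  define p q u v where pq: "p = L $ 1 $ 1" "q = L $ 1 $ 2" "u = L $ 2 $ 1" "v = L $ 2 $ 2"
  note entry = J_form_entry[of L L, unfolded assms]
  have "p * cnj p - q * cnj q = 1" "p * cnj u = q * cnj v" "u * cnj u - v * cnj v = - 1"
    using entry[of 1 1] entry[of 1 2] entry[of 2 2] by (simp_all add: J_mat_entries pq)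
  then have 1: "complex_of_real ((cmod p)\<^sup>2 - (cmod q)\<^sup>2) = 1"
      "complex_of_real ((cmod u)\<^sup>2 - (cmod v)\<^sup>2) = - 1"
    and 2: "cmod p * cmod u = cmod q * cmod v"
    by (simp_all only: of_real_diff complex_norm_square)
      (metis complex_mod_cnj norm_mult)
  have p: "(cmod p)\<^sup>2 = 1 + (cmod q)\<^sup>2" and v: "(cmod v)\<^sup>2 = 1 + (cmod u)\<^sup>2"
    using arg_cong[OF 1(1), of Re] arg_cong[OF 1(2), of Re] by simp_all
  have "(cmod p)\<^sup>2 * (cmod u)\<^sup>2 = (cmod q)\<^sup>2 * (cmod v)\<^sup>2"
    using arg_cong[OF 2, of "\<lambda>x. x\<^sup>2"] by (simp only: power_mult_distrib)
  then have "(cmod u)\<^sup>2 < (cmod p)\<^sup>2"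
    unfolding p v by (simp add: algebra_simps)
  then show ?thesis
    unfolding pq by (rule power_less_imp_less_base) simp
qed

lemma nontangential_limit_radial:
  assumes lim: "nontangential_limit \<Theta> t L" and t: "cmod t = 1"
  obtains Z where "\<And>n. Z n \<in> \<bbbD>" "(\<lambda>n. \<Theta> (Z n)) \<longlonglongrightarrow> L"
proof
  define r where "r n = 1 - 1 / real (Suc (Suc n))" for n
  define Z where "Z n = complex_of_real (r n) * t" for n
  have r: "0 \<le> r n" "r n < 1" for n
    by (simp_all add: r_def)
  have nZ: "cmod (Z n) = r n" for n
    using r[of n] by (simp add: Z_def norm_mult t)
  have nZt: "cmod (Z n - t) = 1 - r n" for n
  proof -
    have "Z n - t = - (complex_of_real (1 - r n) * t)"
      by (simp add: Z_def algebra_simps)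
    then have "cmod (Z n - t) = cmod (complex_of_real (1 - r n)) * cmod t"
      by (simp only: norm_minus_cancel norm_mult)
    then show ?thesis
      using r[of n] by (simp only: t norm_of_real) simp
  qed
  show ZD: "Z n \<in> \<bbbD>" for n
    using r[of n] nZ[of n] by simp
  have ne: "Z n \<noteq> t" for n
    using nZ[of n] r[of n] t by force
  have "r \<longlonglongrightarrow> 1 - 0"
    unfolding r_def by (intro tendsto_intros LIMSEQ_Suc[OF LIMSEQ_Suc[OF lim_1_over_n]])
  then have "(\<lambda>n. complex_of_real (r n) * t) \<longlonglongrightarrow> complex_of_real (1 - 0) * t"
    by (intro tendsto_intros)
  then have Zt: "Z \<longlonglongrightarrow> t"
    by (simp add: Z_def[abs_def])
  \<comment> \<open>On the radius \<open>\<bar>Z n - t\<bar> = 1 - \<bar>Z n\<bar>\<close>, so any aperture above 1 would do.\<close>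
  have "Z n \<in> stolz_region t 2" for n
    using ZD[of n] r[of n] unfolding stolz_region_def by (simp add: nZt nZ)
  then have "filterlim Z (at t within stolz_region t 2) sequentially"
    using Zt ne by (simp add: filterlim_at)
  moreover have "(\<Theta> \<longlongrightarrow> L) (at t within stolz_region t 2)"
    using lim unfolding nontangential_limit_def by simp
  ultimately show "(\<lambda>n. \<Theta> (Z n)) \<longlonglongrightarrow> L"
    by (rule filterlim_compose[rotated])
qed

text \<open>
  If \<open>a = s c\<close> held on the disk then \<open>\<bar>a\<bar> \<le> \<bar>c\<bar>\<close>, also in the limit along a radius. A single boundary
  point with a \<open>J\<close>-unitary limit, where \<open>\<bar>a\<bar> > \<bar>c\<bar>\<close>, excludes this.
\<close>

lemma J_inner_denominator_nonzero:
  assumes inner: "J_inner (\<lambda>z. mat2 (a z) (b z) (c z) (d z))"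
    and s: "\<And>z. z \<in> \<bbbD> \<Longrightarrow> cmod (s z) \<le> 1"
  shows "\<exists>z\<in>\<bbbD>. a z - s z * c z \<noteq> 0"
proof (rule ccontr)
  let ?\<Theta> = "\<lambda>z. mat2 (a z) (b z) (c z) (d z)"
  assume neg: "\<not> (\<exists>z\<in>\<bbbD>. a z - s z * c z \<noteq> 0)"
  have "AE \<phi> in lebesgue_on {0..2 * pi}.
      \<exists>L. nontangential_limit ?\<Theta> (cis \<phi>) L \<and> L ** J_mat ** mat_adjoint L = J_mat"
    using inner unfolding J_inner_def by blast
  moreover have "ae_filter (lebesgue_on {0..2 * pi}) \<noteq> bot"
    by (simp add: ae_filter_eq_bot_iff emeasure_restrict_space)
  ultimately obtain \<phi> and L :: "complex ^ 2 ^ 2" where L: "nontangential_limit ?\<Theta> (cis \<phi>) L"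
      "L ** J_mat ** mat_adjoint L = J_mat"
    using eventually_happens' by blast
  obtain Z where Z: "\<And>n. Z n \<in> \<bbbD>" "(\<lambda>n. ?\<Theta> (Z n)) \<longlonglongrightarrow> L"
    using nontangential_limit_radial[OF L(1)] by auto
  have "cmod (L $ 1 $ 1) \<le> cmod (L $ 2 $ 1)"
  proof (rule LIMSEQ_le)
    show "(\<lambda>n. cmod (?\<Theta> (Z n) $ 1 $ 1)) \<longlonglongrightarrow> cmod (L $ 1 $ 1)"
      "(\<lambda>n. cmod (?\<Theta> (Z n) $ 2 $ 1)) \<longlonglongrightarrow> cmod (L $ 2 $ 1)"
      by (intro tendsto_norm tendsto_vec_nth Z(2))+
    have "cmod (a z) \<le> cmod (c z)" if z: "z \<in> \<bbbD>" for z
    proof -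
      have "a z = s z * c z"
        using neg z by auto
      then show ?thesis
        using mult_right_mono[OF s[OF z] norm_ge_zero[of "c z"]] by (simp add: norm_mult)
    qed
    then show "\<exists>N. \<forall>n\<ge>N. cmod (?\<Theta> (Z n) $ 1 $ 1) \<le> cmod (?\<Theta> (Z n) $ 2 $ 1)"
      using Z(1) by (simp add: mat2_entries)
  qed
  with J_unitary_first_column[OF L(2)] show False
    by simp
qed

lemma holomorphic_eq_off_zeros:
  assumes f: "f holomorphic_on \<bbbD>" and g: "g holomorphic_on \<bbbD>" and m: "m holomorphic_on \<bbbD>"
    and z0: "z0 \<in> \<bbbD>" "m z0 \<noteq> 0"
    and eq: "\<And>z. z \<in> \<bbbD> \<Longrightarrow> m z \<noteq> 0 \<Longrightarrow> f z = g z"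
    and z: "z \<in> \<bbbD>"
  shows "f z = g z"
proof (rule analytic_continuation_open[OF _ _ _ _ _ f g _ z])
  show "open (\<bbbD> \<inter> m -` (- {0}))"
    by (rule continuous_open_preimage[OF holomorphic_on_imp_continuous_on[OF m]]) auto
  show "\<bbbD> \<inter> m -` (- {0}) \<noteq> {}"
    using z0 by blast
qed (use eq in auto)

section \<open>The interpolation problem\<close>

locale schur_interpolation = schur_rkhs s Hs ips + output_stable_pair E T
  for s :: "complex \<Rightarrow> complex" and Hs ips
    and E :: "'x::complex_hilbert_space \<Rightarrow> complex" and T :: "'x \<Rightarrow> 'x" +
  fixes N :: "'x \<Rightarrow> complex"
  assumes N: "bounded_clinear N" and N_adj: "adjoint_vec N = tangential_value s T E"
begin

lemma N_eq: "N x = hardy2_inner (obs_op E T x) s"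
  by (simp only: cinner_adjoint_vec[OF N, symmetric] N_adj
      tangential_value_eq_obs_adj[OF schur_mem_hardy2] cinner_obs_adj[OF schur_mem_hardy2])

text \<open>
  Moving \<open>z\<^sup>n\<close> to the other side of the inner product shifts the coefficients of \<open>obs_op E T x\<close> back \<open>n\<close> times,
  which turns \<open>x\<close> into \<open>T\<^sup>n x\<close>; what remains is the definition of \<open>N\<close>.
\<close>

lemma obs_schur_shift:
  "hardy2_inner (obs_op E T x) (\<lambda>z. s z * on_disk (\<lambda>z. z ^ n) z) = N ((T ^^ n) x)"
proof -
  have eq: "(\<lambda>z. s z * on_disk (\<lambda>z. z ^ n) z) = (\<lambda>z. s z * z ^ n)"
    using schur_vanishes by (auto simp: fun_eq_iff on_disk_def)
  have mem: "(\<lambda>z. s z * z ^ n) \<in> hardy2"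
    using schur_mult(1)[OF on_disk_power_mem[of n]] by (simp only: eq)
  let ?a = "\<lambda>k. E ((T ^^ k) x) * cnj (if k < n then 0 else taylor_coeff s (k - n))"
  have 1: "?a sums hardy2_inner (obs_op E T x) (\<lambda>z. s z * z ^ n)"
    using hardy2_inner_sums[OF obs_mem[of x] mem]
    by (simp only: obs_coeff taylor_coeff_mult_power[OF schur_holomorphic])
  have "(\<lambda>k. ?a (k + n)) sums hardy2_inner (obs_op E T ((T ^^ n) x)) s"
    using hardy2_inner_sums[OF obs_mem[of "(T ^^ n) x"] schur_mem_hardy2]
    by (simp add: obs_coeff funpow_add)
  then have "?a sums hardy2_inner (obs_op E T ((T ^^ n) x)) s"
    by (rule sums_zero_iff_shift[THEN iffD1, rotated]) simp
  with 1 show ?thesis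
    unfolding eq N_eq by (rule sums_unique2)
qed

text \<open>
  The observability operator of \<open>(N, T)\<close> is the one of \<open>(E, T)\<close> followed by the adjoint of multiplication
  by \<open>s\<close>: by \<open>obs_schur_shift\<close> both have the Taylor coefficients \<open>N T\<^sup>n x\<close>. Hence \<open>(N, T)\<close> is
  output-stable.
\<close>

lemma obs_N:
  shows obs_N_mem: "obs_op N T x \<in> hardy2"
    and obs_N_adjoint: "f \<in> hardy2 \<Longrightarrow>
      hardy2_inner f (obs_op N T x) = hardy2_inner (\<lambda>z. s z * f z) (obs_op E T x)"
proof -
  obtain A where A: "\<And>g. g \<in> hardy2 \<Longrightarrow> A g \<in> hardy2"
    "\<And>f g. f \<in> hardy2 \<Longrightarrow> g \<in> hardy2 \<Longrightarrow> hardy2_inner f (A g) = hardy2_inner (\<lambda>z. s z * f z) g"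
    using schur_mult_adjoint by blast
  let ?g = "A (obs_op E T x)"
  have g: "?g \<in> hardy2"
    by (rule A(1)[OF obs_mem])
  have coeff: "taylor_coeff ?g n = N ((T ^^ n) x)" for n
  proof -
    let ?p = "on_disk (\<lambda>z. z ^ n)"
    have p: "?p \<in> hardy2"
      by (rule on_disk_power_mem)
    have "taylor_coeff ?g n = cnj (hardy2_inner ?p ?g)"
      by (simp only: hardy2_inner_power(2)[OF g, symmetric] hardy2.ip_commute[OF g p])
    also have "\<dots> = hardy2_inner (obs_op E T x) (\<lambda>z. s z * ?p z)"
      by (simp only: A(2)[OF p obs_mem] hardy2.ip_commute[OF obs_mem schur_mult(1)[OF p]])
    finally show ?thesis
      by (simp only: obs_schur_shift)
  qed
  have "obs_op N T x = ?g"
  proof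
    fix z
    show "obs_op N T x z = ?g z"
    proof (cases "z \<in> \<bbbD>")
      case True
      have "(\<lambda>n. z ^ n * N ((T ^^ n) x)) sums ?g z"
        using taylor_sums[OF hardy2_holomorphic[OF g] True] by (simp only: coeff mult.commute)
      then show ?thesis
        using True by (simp add: obs_op_def on_disk_def sums_iff)
    next
      case False
      then show ?thesis
        using hardy2_vanishes[OF g False] obs_op_vanishes[OF False] by simp
    qed
  qed
  with g A(2)[OF _ obs_mem] show "obs_op N T x \<in> hardy2"
    and "f \<in> hardy2 \<Longrightarrow>
      hardy2_inner f (obs_op N T x) = hardy2_inner (\<lambda>z. s z * f z) (obs_op E T x)"
    by simp_all
qed

lemma obs_N_norm_le: "ip_norm hardy2_inner (obs_op N T x) \<le> ip_norm hardy2_inner (obs_op E T x)"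
proof (cases "ip_norm hardy2_inner (obs_op N T x) = 0")
  case True
  then show ?thesis
    using hardy2.norm_nonneg[OF obs_mem[of x]] by simp
next
  case False
  let ?g = "obs_op N T x"
  have pos: "0 < ip_norm hardy2_inner ?g"
    using False hardy2.norm_nonneg[OF obs_N_mem[of x]] by linarith
  have "complex_of_real ((ip_norm hardy2_inner ?g)\<^sup>2) = hardy2_inner (\<lambda>z. s z * ?g z) (obs_op E T x)"
    by (simp only: hardy2.ip_self[OF obs_N_mem, symmetric] obs_N_adjoint[OF obs_N_mem])
  then have "(ip_norm hardy2_inner ?g)\<^sup>2 = cmod (hardy2_inner (\<lambda>z. s z * ?g z) (obs_op E T x))"
    by (metis norm_of_real abs_power2)
  also have "\<dots> \<le> ip_norm hardy2_inner (\<lambda>z. s z * ?g z) * ip_norm hardy2_inner (obs_op E T x)"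
    by (rule hardy2.cauchy_schwarz[OF schur_mult(1)[OF obs_N_mem] obs_mem])
  also have "\<dots> \<le> ip_norm hardy2_inner ?g * ip_norm hardy2_inner (obs_op E T x)"
    by (rule mult_right_mono[OF schur_mult(2)[OF obs_N_mem] hardy2.norm_nonneg[OF obs_mem]])
  finally show ?thesis
    using pos by (simp add: power2_eq_square)
qed

sublocale companion: output_stable_pair N T
proof
  obtain C where "\<And>x. ip_norm hardy2_inner (obs_op E T x) \<le> C * norm x"
    using obs_bounded by blast
  then show "output_stable N T"
    unfolding output_stable_def hardy2_norm_eq
    using obs_N_mem obs_N_norm_le order_trans by blast
qed (rule T, rule N)

text \<open>
  The function \<open>z \<mapsto> F\<^sup>s(z) x\<close>, written without resolvents. It is the image of \<open>obs_op E T x\<close> under the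
  adjoint of the inclusion in the Hardy space, which is why inner products with it compute \<open>f(T\<^sup>*)E\<^sup>*\<close>.
\<close>

definition Fs :: "'x \<Rightarrow> complex \<Rightarrow> complex" where
  "Fs x = (\<lambda>z. obs_op E T x z - s z * obs_op N T x z)"

lemma Fs_mem: "Fs x \<in> Hs"
  and ip_Fs: "f \<in> Hs \<Longrightarrow> ips f (Fs x) = cinner (obs_adj E T f) x"
proof -
  note incl = inclusion_adjoint[OF obs_mem[of x] obs_N_mem[of x] obs_N_adjoint]
  show "Fs x \<in> Hs"
    unfolding Fs_def by (rule incl(1))
  assume f: "f \<in> Hs"
  have "ips f (Fs x) = hardy2_inner f (obs_op E T x)"
    unfolding Fs_def by (rule incl(2)[OF _ f])
  also have "\<dots> = cnj (hardy2_inner (obs_op E T x) f)"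
    by (rule hardy2.ip_commute[OF contained_in_hardy2(1)[OF f] obs_mem])
  also have "\<dots> = cinner (obs_adj E T f) x"
    by (simp only: cinner_obs_adj[OF contained_in_hardy2(1)[OF f], symmetric]
        cinner_commute[of "obs_adj E T f" x])
  finally show "ips f (Fs x) = cinner (obs_adj E T f) x" .
qed

abbreviation pick_op :: "'x \<Rightarrow> 'x" where
  "pick_op x \<equiv> obs_adj E T (obs_op E T x) - obs_adj N T (obs_op N T x)"

lemma cinner_pick_op:
  "cinner y (pick_op x) = hardy2_inner (obs_op E T y) (obs_op E T x) -
    hardy2_inner (obs_op N T y) (obs_op N T x)"
  by (simp only: cinner_diff_right cinner_obs_adj[OF obs_mem]
      companion.cinner_obs_adj[OF obs_N_mem])

lemma pick_op_eq: "obs_adj E T (Fs x) = pick_op x"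
proof (rule cinner_ext)
  fix y
  let ?g = "\<lambda>z. s z * obs_op N T x z"
  have g: "?g \<in> hardy2"
    by (rule schur_mult(1)[OF obs_N_mem])
  have "cinner y (obs_adj E T (Fs x)) = hardy2_inner (obs_op E T y) (obs_op E T x) -
      hardy2_inner (obs_op E T y) ?g"
    unfolding cinner_obs_adj[OF contained_in_hardy2(1)[OF Fs_mem]]
    unfolding Fs_def by (rule hardy2.ip_diff_right[OF obs_mem g obs_mem])
  also have "hardy2_inner (obs_op E T y) ?g = hardy2_inner (obs_op N T y) (obs_op N T x)"
    by (simp only: hardy2.ip_commute[OF obs_mem g] obs_N_adjoint[OF obs_N_mem, symmetric]
        hardy2.ip_commute[OF obs_N_mem obs_N_mem, of y x])
  finally show "cinner y (obs_adj E T (Fs x)) = cinner y (pick_op x)"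
    by (simp only: cinner_pick_op)
qed

text \<open>
  \<open>\<parallel>P x\<parallel>\<^sup>2 = \<langle>P x, P x\<rangle>\<close> is bounded by a multiple of \<open>\<parallel>P x\<parallel> \<parallel>obs_op E T x\<parallel>\<close>, so a bounded inverse of \<open>P\<close>
  makes the observability operator bounded below. This is what makes \<open>T\<close> power bounded.
\<close>

lemma obs_bounded_below:
  assumes bij: "bij pick_op" and bounded: "bounded_clinear (inv pick_op)"
  obtains B where "\<And>x. norm x \<le> B * ip_norm hardy2_inner (obs_op E T x)"
proof -
  obtain K where K: "K > 0" "\<And>x. norm (inv pick_op x) \<le> norm x * K"
    using bounded_clinearD(4)[OF bounded] by blast
  obtain C where C: "\<And>x. ip_norm hardy2_inner (obs_op E T x) \<le> C * norm x"
    using obs_bounded by blast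
  let ?n = "\<lambda>x. ip_norm hardy2_inner (obs_op E T x)"
  have "norm (pick_op x) \<le> 2 * \<bar>C\<bar> * ?n x" for x
  proof (cases "norm (pick_op x) = 0")
    case True
    then show ?thesis
      using hardy2.norm_nonneg[OF obs_mem[of x]] by simp
  next
    case False
    let ?y = "pick_op x"
    have "complex_of_real ((norm ?y)\<^sup>2) = hardy2_inner (obs_op E T ?y) (obs_op E T x) -
        hardy2_inner (obs_op N T ?y) (obs_op N T x)"
      unfolding cinner_self[symmetric] by (rule cinner_pick_op)
    then have "(norm ?y)\<^sup>2 = cmod (hardy2_inner (obs_op E T ?y) (obs_op E T x) -
        hardy2_inner (obs_op N T ?y) (obs_op N T x))"
      by (metis norm_of_real abs_power2)
    also have "\<dots> \<le> ?n ?y * ?n x + ?n ?y * ?n x"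
    proof (rule order_trans[OF norm_triangle_ineq4 add_mono])
      show "cmod (hardy2_inner (obs_op E T ?y) (obs_op E T x)) \<le> ?n ?y * ?n x"
        by (rule hardy2.cauchy_schwarz[OF obs_mem obs_mem])
      show "cmod (hardy2_inner (obs_op N T ?y) (obs_op N T x)) \<le> ?n ?y * ?n x"
        by (rule order_trans[OF hardy2.cauchy_schwarz[OF obs_N_mem obs_N_mem]
              mult_mono[OF obs_N_norm_le obs_N_norm_le
                hardy2.norm_nonneg[OF obs_mem] hardy2.norm_nonneg[OF obs_N_mem]]])
    qed
    also have "\<dots> = 2 * (?n ?y * ?n x)"
      by simp
    also have "\<dots> \<le> 2 * (\<bar>C\<bar> * norm ?y * ?n x)"
    proof -
      have "?n ?y \<le> \<bar>C\<bar> * norm ?y"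
        using C[of ?y] by (meson abs_ge_self mult_right_mono norm_ge_zero order_trans)
      then show ?thesis
        using mult_right_mono[OF _ hardy2.norm_nonneg[OF obs_mem[of x]]] by simp
    qed
    finally have "norm ?y * norm ?y \<le> norm ?y * (2 * \<bar>C\<bar> * ?n x)"
      by (simp add: power2_eq_square mult_ac)
    then show ?thesis
      by (rule mult_left_le_imp_le) (use False in simp)
  qed
  note pick_le = this
  have "norm x \<le> (2 * \<bar>C\<bar> * K) * ?n x" for x
  proof -
    have "norm x \<le> norm (pick_op x) * K"
      using K(2)[of "pick_op x"] by (simp only: inv_f_f[OF bij_is_inj[OF bij]])
    also have "\<dots> \<le> (2 * \<bar>C\<bar> * ?n x) * K"
      by (rule mult_right_mono[OF pick_le less_imp_le[OF K(1)]])
    finally show ?thesis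
      by (simp only: mult_ac)
  qed
  with that show ?thesis
    by blast
qed

end

text \<open>
  Multiply the matrix identity by the row \<open>(1, - s)\<close> from the left and by the column \<open>(1, - s')\<^sup>*\<close> from the
  right. This turns \<open>J\<close> into \<open>1 - s s'\<^sup>*\<close> and \<open>\<Theta>\<close> into
  \<open>(a - s c) (1, - \<sigma>)\<close>, by the relation that defines \<open>\<sigma>\<close>.
\<close>

lemma kernel_split_from_J_form:
  assumes J: "map_matrix (\<lambda>w. w / k) (J_mat - mat2 a b c d ** J_mat ** mat_adjoint (mat2 a' b' c' d')) =
      mat2 x11 x12 x21 x22"
    and \<sigma>: "b - s * d = - (\<sigma> * (a - s * c))" and \<sigma>': "b' - s' * d' = - (\<sigma>' * (a' - s' * c'))"
  shows "(1 - s * cnj s') / k = (a - s * c) * ((1 - \<sigma> * cnj \<sigma>') / k) * cnj (a' - s' * c') +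
    (x11 - cnj s' * x12 - s * (x21 - cnj s' * x22))"
proof -
  have entry: "(J_mat $ i $ j - (mat2 a b c d $ i $ 1 * cnj (mat2 a' b' c' d' $ j $ 1) -
      mat2 a b c d $ i $ 2 * cnj (mat2 a' b' c' d' $ j $ 2))) / k = mat2 x11 x12 x21 x22 $ i $ j" for i j
    using arg_cong[OF J, of "\<lambda>A. A $ i $ j"] by (simp add: map_matrix_def J_form_entry)
  have x: "x11 = (1 - (a * cnj a' - b * cnj b')) / k" "x12 = - (a * cnj c' - b * cnj d') / k"
    "x21 = - (c * cnj a' - d * cnj b') / k" "x22 = (- 1 - (c * cnj c' - d * cnj d')) / k"
    using entry[of 1 1] entry[of 1 2] entry[of 2 1] entry[of 2 2]
    by (simp_all add: mat2_entries J_mat_entries)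
  have "x11 - cnj s' * x12 - s * (x21 - cnj s' * x22) =
      (1 - s * cnj s' - (a - s * c) * cnj (a' - s' * c') + (b - s * d) * cnj (b' - s' * d')) / k"
    unfolding x by (simp add: divide_inverse) algebra
  also have "\<dots> = (1 - s * cnj s') / k -
      (a - s * c) * ((1 - \<sigma> * cnj \<sigma>') / k) * cnj (a' - s' * c')"
    unfolding \<sigma> \<sigma>' by (simp add: divide_inverse) algebra
  finally show ?thesis
    by simp
qed

theorem theorem2p2:
  fixes s \<sigma> a b c d :: "complex \<Rightarrow> complex"
    and T P :: "'x::complex_hilbert_space \<Rightarrow> 'x"
    and E N \<xi> :: "'x \<Rightarrow> complex"
    and \<Theta> :: "complex \<Rightarrow> complex ^ 2 ^ 2"
    and Hs H\<sigma> :: "(complex \<Rightarrow> complex) set"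
    and ips ip\<sigma> :: "(complex \<Rightarrow> complex) \<Rightarrow> (complex \<Rightarrow> complex) \<Rightarrow> complex"
    and p :: "complex \<Rightarrow> complex"
    and M :: "(complex \<Rightarrow> complex) \<Rightarrow> complex \<Rightarrow> complex"
  assumes s: "s \<in> schur_class"
    and T: "bounded_clinear T"
    and E: "bounded_clinear E"
    and \<xi>: "bounded_clinear \<xi>"
    and stable: "output_stable E T"
    and observable: "observable E T"
    and N: "bounded_clinear N" "adjoint_vec N = tangential_value s T E"
    and P: "P = (\<lambda>x. obs_adj E T (obs_op E T x) - obs_adj N T (obs_op N T x))"
    and P_pos: "strictly_positive_operator P"
    and \<Theta>: "\<Theta> = (\<lambda>z. mat2 (a z) (b z) (c z) (d z))"
    and \<Theta>_inner: "J_inner \<Theta>"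
    and \<Theta>_kernel: "\<And>z \<zeta>. z \<in> \<bbbD> \<Longrightarrow> \<zeta> \<in> \<bbbD> \<Longrightarrow>
      map_matrix (\<lambda>w. w / (1 - z * cnj \<zeta>)) (J_mat - \<Theta> z ** J_mat ** mat_adjoint (\<Theta> \<zeta>)) =
      (let R = (\<lambda>v. resolvent T z (inv P (resolvent (cadjoint T) (cnj \<zeta>) v)))
       in mat2 (E (R (adjoint_vec E))) (E (R (adjoint_vec N)))
               (N (R (adjoint_vec E))) (N (R (adjoint_vec N))))"
    and \<sigma>: "\<sigma> \<in> schur_class"
      "\<And>z. z \<in> \<bbbD> \<Longrightarrow> a z - c z * s z \<noteq> 0 \<Longrightarrow> \<sigma> z = (d z * s z - b z) / (a z - c z * s z)"
    and Hs: "de_branges_rovnyak_space s Hs ips"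
    and H\<sigma>: "de_branges_rovnyak_space \<sigma> H\<sigma> ip\<sigma>"
    and p: "p = on_disk (\<lambda>z. Fs_op s E N T z (inv P (adjoint_vec \<xi>)))"
    and M: "M = (\<lambda>h. on_disk (\<lambda>z. (a z - s z * c z) * h z))"
  shows "(\<forall>f. f \<in> Hs \<and> tangential_value f T E = adjoint_vec \<xi> \<longleftrightarrow>
              (\<exists>h\<in>H\<sigma>. f = (\<lambda>z. p z + M h z))) \<and>
         (\<forall>h\<in>H\<sigma>. p \<in> Hs \<and> M h \<in> Hs \<and> ips p (M h) = 0) \<and>
         (\<forall>h\<in>H\<sigma>. M h \<in> Hs \<and> ip_norm ips (M h) = ip_norm ip\<sigma> h) \<and>
         (\<forall>h\<in>H\<sigma>. complex_of_real ((ip_norm ips (\<lambda>z. p z + M h z))\<^sup>2) =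
              cinner (inv P (adjoint_vec \<xi>)) (adjoint_vec \<xi>) +
              complex_of_real ((ip_norm ip\<sigma> h)\<^sup>2))"
proof -
  interpret target: schur_rkhs \<sigma> H\<sigma> ip\<sigma>
    using H\<sigma> \<sigma>(1)
    by (simp add: schur_rkhs_def schur_rkhs_axioms_def de_branges_rovnyak_space_def)
  interpret schur_rkhs s Hs ips
    using Hs s by (simp add: schur_rkhs_def schur_rkhs_axioms_def de_branges_rovnyak_space_def)
  interpret schur_interpolation s Hs ips E T N
    using T E stable N by unfold_locales
  define m where "m z = a z - s z * c z" for z
  define e where "e w = resolvent (cadjoint T) (cnj w) (adjoint_vec E) -
      cnj (s w) *\<^sub>C resolvent (cadjoint T) (cnj w) (adjoint_vec N)" for w
  have bij: "bij P" and P_inv: "bounded_clinear (inv P)"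
    using P_pos by (simp_all add: strictly_positive_operator_def)
  obtain B where "\<And>x. norm x \<le> B * ip_norm hardy2_inner (obs_op E T x)"
    using obs_bounded_below bij P_inv unfolding P by blast
  then obtain C where C: "\<And>n x. norm ((T ^^ n) x) \<le> C * norm x"
    using power_bounded_if_bounded_below by blast
  have Fs_resolvent: "Fs x z = E (resolvent T z x) - s z * N (resolvent T z x)" if "z \<in> \<bbbD>" for x z
    by (simp only: Fs_def obs_op_resolvent[OF T E C that] obs_op_resolvent[OF T N(1) C that])
  have Fs_eval: "Fs x w = cinner x (e w)" if w: "w \<in> \<bbbD>" for x w
  proof -
    have "cmod w < 1"
      using w by simp
    note adj = cinner_resolvent_cadjoint[OF T C this]
    show ?thesis
      by (simp only: Fs_resolvent[OF w] e_def cinner_diff_right cinner_scaleC_right adj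
          cinner_adjoint_vec[OF E] cinner_adjoint_vec[OF N(1)] complex_cnj_cnj)
  qed
  have Fs_outside: "Fs x z = 0" if "z \<notin> \<bbbD>" for x z
    by (rule vanishes_outside[OF Fs_mem that])
  have a: "a holomorphic_on \<bbbD>" and b: "b holomorphic_on \<bbbD>" and c: "c holomorphic_on \<bbbD>"
    and d: "d holomorphic_on \<bbbD>"
  proof -
    have "(\<lambda>z. \<Theta> z $ i $ j) holomorphic_on \<bbbD>" for i j
      using \<Theta>_inner unfolding J_inner_def by blast
    from this[of 1 1] this[of 1 2] this[of 2 1] this[of 2 2]
    show "a holomorphic_on \<bbbD>" "b holomorphic_on \<bbbD>" "c holomorphic_on \<bbbD>" "d holomorphic_on \<bbbD>"
      by (simp_all add: \<Theta> mat2_entries)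
  qed
  have m: "m holomorphic_on \<bbbD>"
    unfolding m_def[abs_def] by (intro holomorphic_intros a c schur_holomorphic)
  \<comment> \<open>Holomorphy makes one nonzero value of \<open>m\<close> enough: identities valid off the zeros of \<open>m\<close> extend to the
    disk. This gives the relation between \<open>\<sigma>\<close> and \<open>m\<close> everywhere, and injectivity of multiplication by \<open>m\<close>.\<close>
  obtain z0 where z0: "z0 \<in> \<bbbD>" "m z0 \<noteq> 0"
  proof -
    have "cmod (s z) \<le> 1" if "z \<in> \<bbbD>" for z
      using s that unfolding schur_class_def by blast
    then show ?thesis
      using J_inner_denominator_nonzero[OF \<Theta>_inner[unfolded \<Theta>]] that unfolding m_def by blast
  qed
  have \<sigma>m: "b z - s z * d z = - (\<sigma> z * (a z - s z * c z))" if "z \<in> \<bbbD>" for z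
  proof (rule holomorphic_eq_off_zeros[OF _ _ m z0 _ that])
    show "(\<lambda>z. b z - s z * d z) holomorphic_on \<bbbD>"
      by (intro holomorphic_intros b d schur_holomorphic)
    show "(\<lambda>z. - (\<sigma> z * (a z - s z * c z))) holomorphic_on \<bbbD>"
      by (intro holomorphic_intros a c schur_holomorphic target.schur_holomorphic)
    show "b w - s w * d w = - (\<sigma> w * (a w - s w * c w))" if w: "w \<in> \<bbbD>" "m w \<noteq> 0" for w
      using \<sigma>(2)[OF w(1)] w(2) by (simp add: m_def mult.commute)
  qed
  have split: "dbr_kernel s z w = m z * dbr_kernel \<sigma> z w * cnj (m w) + Fs (inv P (e w)) z"
    if z: "z \<in> \<bbbD>" and w: "w \<in> \<bbbD>" for z w
  proof -
    let ?R = "\<lambda>v. resolvent T z (inv P (resolvent (cadjoint T) (cnj w) v))"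
    have z1: "cmod z < 1"
      using z by simp
    have R_e: "resolvent T z (inv P (e w)) = ?R (adjoint_vec E) - cnj (s w) *\<^sub>C ?R (adjoint_vec N)"
      by (simp only: e_def bounded_clinearD[OF P_inv] bounded_clinearD[OF bounded_clinear_resolvent[OF T C z1]])
    have "Fs (inv P (e w)) z = E (?R (adjoint_vec E)) - cnj (s w) * E (?R (adjoint_vec N)) -
        s z * (N (?R (adjoint_vec E)) - cnj (s w) * N (?R (adjoint_vec N)))"
      by (simp only: Fs_resolvent[OF z] R_e bounded_clinearD(2,3)[OF E] bounded_clinearD(2,3)[OF N(1)]
          scaleC_complex_def)
    moreover have "dbr_kernel s z w = m z * dbr_kernel \<sigma> z w * cnj (m w) +
        (E (?R (adjoint_vec E)) - cnj (s w) * E (?R (adjoint_vec N)) -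
        s z * (N (?R (adjoint_vec E)) - cnj (s w) * N (?R (adjoint_vec N))))"
      unfolding dbr_kernel_def m_def
      by (rule kernel_split_from_J_form[OF \<Theta>_kernel[OF z w, unfolded \<Theta> Let_def] \<sigma>m[OF z] \<sigma>m[OF w]])
    ultimately show ?thesis
      by simp
  qed
  have inverse: "inv P (obs_adj E T (Fs x)) = x" "obs_adj E T (Fs (inv P x)) = x" for x
    using bij_inv_eq_iff[OF bij] unfolding pick_op_eq by (metis P)+
  interpret kernel_splitting "\<bbbD>" "dbr_kernel s" Hs ips "dbr_kernel \<sigma>" H\<sigma> ip\<sigma> m Fs
    "obs_adj E T" "inv P" e
  proof
    show "h = (\<lambda>z. 0)" if h: "h \<in> H\<sigma>" and 0: "(\<lambda>z. m z * h z) = (\<lambda>z. 0)" for h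
    proof
      fix z
      show "h z = 0"
      proof (cases "z \<in> \<bbbD>")
        case True
        have "h holomorphic_on \<bbbD>"
          using target.contained_in_hardy2(1)[OF h] by (rule hardy2_holomorphic)
        then show ?thesis
          by (rule holomorphic_eq_off_zeros[OF _ holomorphic_on_const m z0 _ True])
            (use fun_cong[OF 0] in auto)
      next
        case False
        then show ?thesis
          by (rule target.vanishes_outside[OF h])
      qed
    qed
  qed (rule Fs_mem ip_Fs Fs_eval inverse split; assumption)+
  have p_eq: "p = Fs (inv P (adjoint_vec \<xi>))"
    using Fs_outside by (auto simp: p fun_eq_iff on_disk_def Fs_op_def Fs_resolvent)
  have M_eq: "M h = (\<lambda>z. m z * h z)" if "h \<in> H\<sigma>" for h
    using target.vanishes_outside[OF that] by (auto simp: M fun_eq_iff on_disk_def m_def)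
  have value_eq: "tangential_value f T E = obs_adj E T f" if "f \<in> Hs" for f
    by (rule tangential_value_eq_obs_adj[OF contained_in_hardy2(1)[OF that]])
  have "f \<in> Hs \<and> tangential_value f T E = adjoint_vec \<xi> \<longleftrightarrow> (\<exists>h\<in>H\<sigma>. f = (\<lambda>z. p z + M h z))" for f
  proof -
    have "f \<in> Hs \<and> tangential_value f T E = adjoint_vec \<xi> \<longleftrightarrow>
        f \<in> Hs \<and> obs_adj E T f = adjoint_vec \<xi>"
      using value_eq[of f] by auto
    also have "\<dots> \<longleftrightarrow> (\<exists>h\<in>H\<sigma>. f = (\<lambda>z. p z + m z * h z))"
      unfolding p_eq by (rule solution_iff)
    also have "\<dots> \<longleftrightarrow> (\<exists>h\<in>H\<sigma>. f = (\<lambda>z. p z + M h z))"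
      by (rule bex_cong[OF refl]) (simp only: M_eq)
    finally show ?thesis .
  qed
  moreover have "p \<in> Hs \<and> M h \<in> Hs \<and> ips p (M h) = 0" if "h \<in> H\<sigma>" for h
    by (simp only: p_eq M_eq[OF that] Fs_mem mult_mem(1)[OF that] mult_orthogonal(1)[OF that] simp_thms)
  moreover have "ip_norm ips (M h) = ip_norm ip\<sigma> h" if "h \<in> H\<sigma>" for h
    by (simp only: M_eq[OF that] mult_isometric[OF that])
  moreover have "complex_of_real ((ip_norm ips (\<lambda>z. p z + M h z))\<^sup>2) =
      cinner (inv P (adjoint_vec \<xi>)) (adjoint_vec \<xi>) + complex_of_real ((ip_norm ip\<sigma> h)\<^sup>2)"
    if "h \<in> H\<sigma>" for h
    by (simp only: p_eq M_eq[OF that] solution_norm[OF that])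
  ultimately show ?thesis
    by blast
qed

end
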